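(* Let $l\in\mathbb{N}$ and $H(x)=x^{l+1}+\sum_{j=l+2}^\infty h_jx^j\in\boldsymbol{k}[[x]]$. Let $T\in\Gamma^\infty_1$ transform $(\mathrm{AJ}_\infty(H))$ to $(\mathrm{AJ}_\infty(\widetilde H))$, where $\widetilde H(x)=x^{l+1}+\delta x^{2l+1}$ with some $\delta\in\boldsymbol{k}$. For $c\in\boldsymbol{k}$ put $\widetilde\Phi_c(x)=x+cx^{l+1}+\sum_{p=2}^\infty Q^{l+1}_{pl+1}(c,\delta)x^{pl+1}$, with the universal polynomials $Q^{l+1}_{pl+1}$ defined in the context. (i) For every $c_1\in\boldsymbol{E}_l$ and $c_{l+1}\in\boldsymbol{k}$, $$\widehat\Phi_{c_1,c_{l+1}}(x)=(L_{c_1}\circ\widetilde\Phi_{c_1^{-1}c_{l+1}})(x)=c_1x+c_{l+1}x^{l+1}+\sum_{p=2}^\infty c_1Q^{l+1}_{pl+1}(c_1^{-1}c_{l+1},\delta)\,x^{pl+1}$$ is the unique element of $\mathcal{S}(\mathrm{AJ}_\infty(\widetilde H))$ with coefficients $c_1$ at $x$ and $c_{l+1}$ at $x^{l+1}$, and every element of $\mathcal{S}(\mathrm{AJ}_\infty(\widetilde H))$ is of this form; $\mathcal{S}(\mathrm{AJ}_\infty(\widetilde H))\subset\mathcal{N}^{\infty,l}$. The group $\mathcal{S}(\mathrm{AJ}_\infty(\widetilde H))$ is the (internal) direct product of the subgroups $\mathcal{L}_l$ and $\mathcal{S}_1(\mathrm{AJ}_\infty(\widetilde H))$, and it is isomorphic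 to $\Gamma^{l,l}\cong(\boldsymbol{E}_l\times\boldsymbol{k},\diamond)$. (ii) For every $c_1\in\boldsymbol{E}_l$ and $c_{l+1}\in\boldsymbol{k}$, $$\Phi_{c_1,c_{l+1}}=T\circ\widehat\Phi_{c_1,c_{l+1}}\circ T^{-1}=(T\circ L_{c_1}\circ T^{-1})\circ(T\circ\widetilde\Phi_{c_1^{-1}c_{l+1}}\circ T^{-1})$$ is a solution of $(\mathrm{AJ}_\infty(H))$, and every element of $\mathcal{S}(\mathrm{AJ}_\infty(H))$ is of this form for a unique pair $(c_1,c_{l+1})\in\boldsymbol{E}_l\times\boldsymbol{k}$. The group $\mathcal{S}(\mathrm{AJ}_\infty(H))$ is the direct product of its subgroups $\{T\circ F\circ T^{-1}:F\in\mathcal{L}_l\}$ and $\{T\circ F\circ T^{-1}:F\in\mathcal{S}_1(\mathrm{AJ}_\infty(\widetilde H))\}$, and it is also isomorphic to $\Gamma^{l,l}\cong(\boldsymbol{E}_l\times\boldsymbol{k},\diamond)$.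
   Context: $\boldsymbol{k}$ is a field of characteristic $0$, $\boldsymbol{q}\subset\boldsymbol{k}$ its prime field. $\Gamma^\infty$ is the group under substitution $\circ$ of series $f\in\boldsymbol{k}[[x]]$ of order exactly $1$; $\Gamma^\infty_1=\{f\in\Gamma^\infty:f\equiv x\bmod x^2\}$; inverses $T^{-1}$ are with respect to substitution. For $s\in\mathbb{N}$, $\Gamma^s$ is the analogous group of $s$-truncated series (polynomials of degree $\le s$, substitution mod $x^{s+1}$). $\boldsymbol{E}_l=\{c\in\boldsymbol{k}:c^l=1\}$, $L_c(x)=cx$, $\mathcal{L}_l=\{L_c:c\in\boldsymbol{E}_l\}$. $\mathcal{N}^{\infty,l}=\{f\in\Gamma^\infty:f(x)=\sum_{j\ge0}c_{jl+1}x^{jl+1}\}$. $(\mathrm{AJ}_\infty(H))$ is the equation $(H\circ\Phi)(x)=\frac{d\Phi}{dx}\cdot H(x)$; $\mathcal{S}(\mathrm{AJ}_\infty(H))$ is the group of its solutions $\Phi\in\Gamma^\infty$, and $\mathcal{S}_1(\mathrm{AJ}_\infty(H))=\mathcal{S}(\mathrm{AJ}_\infty(H))\cap\Gamma^\infty_1$. $T\in\Gamma^\infty_1$ transforms $(\mathrm{AJ}_\infty(H))$ to $(\mathrm{AJ}_\infty(\widetilde H))$ if $\widetilde H(x)=\left(\frac{dT}{dx}\right)^{-1}(H\circ T)(x)$ (multiplicative inverse of $dT/dx$). $\Gamma^{l,l}=\{c_1x+c_{l+1}x^{l+1}\in\Gamma^{l+1}:c_1\in\boldsymbol{E}_l,\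 c_{l+1}\in\boldsymbol{k}\}$, a group under substitution mod $x^{l+2}$. The operation $\diamond$ on $\boldsymbol{E}_l\times\boldsymbol{k}$ is $(c_1,c_2)\diamond(d_1,d_2)=(c_1d_1,\,c_1d_2+d_1c_2)$. For $1\le i\le n$: $U_{n,i}=\{\overline{u}_n=(u_1,\dots,u_n)\in\{0,\dots,i\}^n:\sum_{j=1}^n u_j=i,\ \sum_{j=1}^n ju_j=n\}$ and $B_{\overline{u}_n}=i!/\prod_{j=1}^n u_j!$ for $\overline u_n\in U_{n,i}$. $U^{l+1}_{n,i}$ is the set of $\overline{u}_n\in U_{n,i}$ such that $u_j=0$ for all $j\in\{2,\dots,n-i+1\}$ with $j\not\equiv1\pmod l$ and for all $j\in\{n-i+2,\dots,n\}$. $\check{U}^{l+1}_{n,l+1}$ is the set of $\overline{u}_n\in U^{l+1}_{n,l+1}$ with moreover $u_{n-l}=0$. The polynomials $Q^{l+1}_{rl+1}(y,t)\in\boldsymbol{q}[y,t]$, $r\ge1$, are defined by $Q^{l+1}_{l+1}(y,t)=y$ and, for $r\ge2$ with $n=(r+1)l+1$, $$Q^{l+1}_{rl+1}=\frac{1}{(r-1)l}\Big(\sum_{\overline{u}_n\in\check{U}^{l+1}_{n,l+1}}B_{\overline{u}_n}\prod_{j=1}^{r-1}(Q^{l+1}_{jl+1})^{u_{jl+1}}+t\sum_{\overline{u}_n\in U^{l+1}_{n,2l+1}}B_{\overline{u}_n}\prod_{j=1}^{r-1}(Q^{l+1}_{jl+1})^{u_{jl+1}}-t((r-1)l+1)Q^{l+1}_{(r-1)l+1}\Big).$$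 *)

theory Defs
  imports
    "HOL-Computational_Algebra.Polynomial"
    "HOL-Computational_Algebra.Formal_Power_Series"
    "HOL-Algebra.Coset"
begin

unbundle fps_syntax

definition Gamma_inf :: "'a::field fps monoid" where
  "Gamma_inf = \<lparr>carrier = {f. f $ 0 = 0 \<and> f $ 1 \<noteq> 0}, mult = (\<lambda>f g. f oo g), one = fps_X\<rparr>"

definition Gamma1_inf :: "'a::field fps set" where
  "Gamma1_inf = {f \<in> carrier Gamma_inf. f $ 1 = 1}"

definition Gamma_trunc :: "nat \<Rightarrow> 'a::field poly monoid" where
  "Gamma_trunc s =
    \<lparr>carrier = {p. degree p \<le> s \<and> coeff p 0 = 0 \<and> coeff p 1 \<noteq> 0},
     mult = (\<lambda>p q. poly_cutoff (Suc s) (pcompose p q)),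
     one = [:0, 1:]\<rparr>"

definition E_roots :: "nat \<Rightarrow> 'a::field set" where
  "E_roots l = {c. c ^ l = 1}"

definition L_lin :: "'a::field \<Rightarrow> 'a fps" where
  "L_lin c = fps_const c * fps_X"

definition L_set :: "nat \<Rightarrow> 'a::field fps set" where
  "L_set l = L_lin ` E_roots l"

definition N_inf :: "nat \<Rightarrow> 'a::field fps set" where
  "N_inf l = {f \<in> carrier Gamma_inf. \<forall>m. f $ m \<noteq> 0 \<longrightarrow> (\<exists>j. m = j * l + 1)}"

definition Gamma_ll :: "nat \<Rightarrow> 'a::field poly monoid" where
  "Gamma_ll l = (Gamma_trunc (l + 1))
    \<lparr>carrier := {p \<in> carrier (Gamma_trunc (l + 1)).
        \<exists>c\<^sub>1\<in>E_roots l. \<exists>c\<^sub>2. p = monom c\<^sub>1 1 + monom c\<^sub>2 (l + 1)}\<rparr>"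

definition diamond_group :: "nat \<Rightarrow> ('a::field \<times> 'a) monoid" where
  "diamond_group l =
    \<lparr>carrier = E_roots l \<times> UNIV,
     mult = (\<lambda>(c\<^sub>1, c\<^sub>2) (d\<^sub>1, d\<^sub>2). (c\<^sub>1 * d\<^sub>1, c\<^sub>1 * d\<^sub>2 + d\<^sub>1 * c\<^sub>2)),
     one = (1, 0)\<rparr>"

definition internal_direct_product :: "('b, 'c) monoid_scheme \<Rightarrow> 'b set \<Rightarrow> 'b set \<Rightarrow> bool" where
  "internal_direct_product G A B \<longleftrightarrow>
     normal A G \<and> normal B G \<and> A \<inter> B = {\<one>\<^bsub>G\<^esub>} \<and> A <#>\<^bsub>G\<^esub> B = carrier G"

definition AJ_sol :: "'a::field fps \<Rightarrow> 'a fps set" where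
  "AJ_sol H = {\<Phi> \<in> carrier Gamma_inf. (H oo \<Phi>) = fps_deriv \<Phi> * H}"

definition AJ_sol1 :: "'a::field fps \<Rightarrow> 'a fps set" where
  "AJ_sol1 H = AJ_sol H \<inter> Gamma1_inf"

definition AJ_group :: "'a::field fps \<Rightarrow> 'a fps monoid" where
  "AJ_group H = Gamma_inf\<lparr>carrier := AJ_sol H\<rparr>"

definition transforms_AJ :: "'a::field fps \<Rightarrow> 'a fps \<Rightarrow> 'a fps \<Rightarrow> bool" where
  "transforms_AJ T H H' \<longleftrightarrow> T \<in> Gamma1_inf \<and> H' = inverse (fps_deriv T) * (H oo T)"

definition U_idx :: "nat \<Rightarrow> nat \<Rightarrow> (nat \<Rightarrow> nat) set" where
  "U_idx n i = {u \<in> {1..n} \<rightarrow>\<^sub>E {0..i}. (\<Sum>j=1..n. u j) = i \<and> (\<Sum>j=1..n. j * u j) = n}"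

definition B_coeff :: "nat \<Rightarrow> nat \<Rightarrow> (nat \<Rightarrow> nat) \<Rightarrow> rat" where
  "B_coeff n i u = fact i / (\<Prod>j=1..n. fact (u j))"

text \<open>
  In the next two definitions \<open>l\<close> stands for the superscript \<open>l + 1\<close> of
  $U^{l+1}_{n,i}$ and $\check U^{l+1}_{n,l+1}$.
\<close>

definition U_res :: "nat \<Rightarrow> nat \<Rightarrow> nat \<Rightarrow> (nat \<Rightarrow> nat) set" where
  "U_res l n i = {u \<in> U_idx n i.
     (\<forall>j\<in>{2..n - i + 1}. j mod l \<noteq> 1 mod l \<longrightarrow> u j = 0) \<and>
     (\<forall>j\<in>{n - i + 2..n}. u j = 0)}"

definition U_check :: "nat \<Rightarrow> nat \<Rightarrow> (nat \<Rightarrow> nat) set" where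
  "U_check l n = {u \<in> U_res l n (l + 1). u (n - l) = 0}"

text \<open>
  The prime field of a field of characteristic 0 is the image of \<^typ>\<open>rat\<close> under
  \<^const>\<open>of_rat\<close>. A polynomial in $y$ and $t$ over it is represented in \<^typ>\<open>rat poly poly\<close>;
  $y$ is the outer and $t$ the inner variable. \<open>Q_pol l r\<close> is $Q^{l+1}_{rl+1}$;
  the value 1 at \<open>r = 0\<close> is a dummy.
\<close>

abbreviation scal2 :: "rat \<Rightarrow> rat poly poly" where
  "scal2 a \<equiv> [:[:a:]:]"

abbreviation var_y :: "rat poly poly" where
  "var_y \<equiv> [:0, 1:]"

abbreviation var_t :: "rat poly poly" where
  "var_t \<equiv> [:[:0, 1:]:]"

fun Q_pol :: "nat \<Rightarrow> nat \<Rightarrow> rat poly poly" where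
  "Q_pol l r =
    (if r = 0 then 1
     else if r = 1 then var_y
     else let n = (r + 1) * l + 1 in
       scal2 (1 / of_nat ((r - 1) * l)) *
         ((\<Sum>u\<in>U_check l n. scal2 (B_coeff n (l + 1) u) * (\<Prod>j=1..r-1. Q_pol l j ^ u (j * l + 1)))
          + var_t * (\<Sum>u\<in>U_res l n (2 * l + 1).
              scal2 (B_coeff n (2 * l + 1) u) * (\<Prod>j=1..r-1. Q_pol l j ^ u (j * l + 1)))
          - var_t * of_nat ((r - 1) * l + 1) * Q_pol l (r - 1)))"

declare Q_pol.simps [simp del]

definition eval2 :: "rat poly poly \<Rightarrow> 'a::field_char_0 \<Rightarrow> 'a \<Rightarrow> 'a" where
  "eval2 P c d = poly (map_poly (\<lambda>p. poly (map_poly of_rat p) d) P) c"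

text \<open>\<open>lseries l a b q\<close> is $a x + b x^{l+1} + \sum_{p \ge 2} q(p)\, x^{pl+1}$ for \<open>l \<ge> 1\<close>.\<close>

definition lseries :: "nat \<Rightarrow> 'a::field \<Rightarrow> 'a \<Rightarrow> (nat \<Rightarrow> 'a) \<Rightarrow> 'a fps" where
  "lseries l a b q = Abs_fps (\<lambda>m.
     if m = 1 then a
     else if m = l + 1 then b
     else if \<exists>p\<ge>2. m = p * l + 1 then q ((m - 1) div l)
     else 0)"

definition Phi_tilde :: "nat \<Rightarrow> 'a::field_char_0 \<Rightarrow> 'a \<Rightarrow> 'a fps" where
  "Phi_tilde l \<delta> c = lseries l 1 c (\<lambda>p. eval2 (Q_pol l p) c \<delta>)"

definition Phi_hat :: "nat \<Rightarrow> 'a::field_char_0 \<Rightarrow> 'a \<Rightarrow> 'a \<Rightarrow> 'a fps" where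
  "Phi_hat l \<delta> c\<^sub>1 c = L_lin c\<^sub>1 oo Phi_tilde l \<delta> (inverse c\<^sub>1 * c)"

definition conj_T :: "'a::field fps \<Rightarrow> 'a fps \<Rightarrow> 'a fps" where
  "conj_T T F = (T oo F) oo fps_inv T"

end

theory Submission
  imports Defs "HOL-Computational_Algebra.Polynomial_FPS"
begin

text \<open>
  Let \<open>\<Phi> = c\<^sub>1 x + c\<^sub>2 x\<^sup>2 + \<dots>\<close> and \<open>H = x\<^sup>l\<^sup>+\<^sup>1 + \<delta> x\<^sup>2\<^sup>l\<^sup>+\<^sup>1\<close>. At \<open>x\<^sup>l\<^sup>+\<^sup>1\<close> the equation \<open>H \<circ> \<Phi> = \<Phi>' H\<close>
  says \<open>c\<^sub>1\<^sup>l = 1\<close>. At \<open>x\<^sup>m\<^sup>+\<^sup>l\<close> with \<open>m \<ge> 2\<close> the coefficient \<open>c\<^sub>m\<close> enters linearly, with factor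
  \<open>l + 1\<close> on the left (\<open>fps_power_nth_first_difference\<close>) and \<open>m\<close> on the right, and all else
  depends on earlier coefficients. In characteristic zero every coefficient except \<open>c\<^sub>l\<^sub>+\<^sub>1\<close> is
  therefore determined by its predecessors, and a solution is determined by the pair
  \<open>(c\<^sub>1, c\<^sub>l\<^sub>+\<^sub>1)\<close> (\<open>AJ_normal_form_sol_unique\<close>).

  Conversely every pair with \<open>c\<^sub>1\<^sup>l = 1\<close> occurs. For \<open>c\<^sub>1 = 1\<close> the multinomial expansion of the powers
  of a series supported on \<open>l\<nat> + 1\<close> (\<open>fps_power_nth_U_res\<close>) turns the equation into the
  recursion that defines the polynomials \<open>Q_pol\<close>, so \<open>Phi_tilde\<close> is a solution
  (\<open>Phi_tilde_sol\<close>); the general case follows by composing with the solution \<open>L_lin c\<^sub>1\<close>. Hence all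
  solutions are the \<open>Phi_hat\<close> and are supported on \<open>l\<nat> + 1\<close>.

  Because of this gap in the support, composing two solutions multiplies their coefficient pairs by
  the law \<open>\<diamond>\<close>, so the solution group is isomorphic to \<open>diamond_group l\<close>
  (\<open>AJ_normal_form_coeffs_iso\<close>) and in particular commutative. The same computation with truncated
  series identifies \<open>diamond_group l\<close> with \<open>Gamma_ll l\<close> (\<open>jet_iso\<close>), and the factorisation of
  \<open>Phi_hat\<close> gives the direct product. Finally the chain rule shows that conjugation with \<open>T\<close> is an
  isomorphism from the solutions for \<open>H'\<close> onto those for \<open>H\<close> (\<open>conj_T_iso\<close>), and it carries every
  assertion of the first part over to the second.
\<close>

section \<open>Coefficients of powers of a power series\<close>

lemma PiE_bounded_by_sum_iff:
  fixes u :: "'b \<Rightarrow> nat"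
  assumes "finite A"
  shows "u \<in> A \<rightarrow>\<^sub>E {0..i} \<and> sum u A = i \<longleftrightarrow> u \<in> extensional A \<and> sum u A = i"
  using assms by (auto simp: PiE_iff intro: member_le_sum)

lemma finite_extensional_sum_eq:
  assumes "finite A"
  shows "finite {u \<in> extensional A. sum u A = (i::nat)}"
proof (rule finite_subset)
  show "{u \<in> extensional A. sum u A = i} \<subseteq> A \<rightarrow>\<^sub>E {0..i}"
    using PiE_bounded_by_sum_iff[OF assms] by blast
qed (use assms in \<open>auto intro: finite_PiE\<close>)

text \<open>
  The multinomial theorem, phrased for divided powers such as \<open>x\<^sup>k / k!\<close>: the
  multinomial coefficients are absorbed into the factors, so that the binomial rule alone
  drives the induction over \<open>A\<close>.
\<close>

lemma divided_power_sum:
  fixes D :: "nat \<Rightarrow> 'b::comm_monoid_add \<Rightarrow> 'c::comm_semiring_1" and A :: "'e set"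
  assumes add: "\<And>i x y. D i (x + y) = (\<Sum>k\<le>i. D k x * D (i - k) y)"
    and zero: "\<And>i. D i 0 = (if i = 0 then 1 else 0)"
    and "finite A"
  shows "D i (sum g A) = (\<Sum>u\<in>{u \<in> extensional A. sum u A = i}. \<Prod>j\<in>A. D (u j) (g j))"
  using \<open>finite A\<close>
proof (induction A arbitrary: i rule: finite_induct)
  case empty
  show ?case by (auto simp: zero)
next
  case (insert a A)
  let ?P = "\<lambda>A i. {u \<in> extensional A. sum u A = (i::nat)}"
  have upd: "sum (v(a := k)) A = sum v A" "(\<Prod>j\<in>A. D ((v(a := k)) j) (g j)) = (\<Prod>j\<in>A. D (v j) (g j))"
    for v :: "'e \<Rightarrow> nat" and k
    using insert.hyps by (auto intro!: sum.cong prod.cong)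
  have "D i (sum g (insert a A)) = (\<Sum>k\<le>i. D k (g a) * (\<Sum>u\<in>?P A (i - k). \<Prod>j\<in>A. D (u j) (g j)))"
    using insert.hyps by (simp add: add insert.IH)
  also have "\<dots> = (\<Sum>(k, u)\<in>(SIGMA k:{..i}. ?P A (i - k)). D k (g a) * (\<Prod>j\<in>A. D (u j) (g j)))"
    using finite_extensional_sum_eq[OF insert.hyps(1)] by (simp add: sum_distrib_left sum.Sigma)
  also have "\<dots> = (\<Sum>u\<in>?P (insert a A) i. \<Prod>j\<in>insert a A. D (u j) (g j))"
  \<comment> \<open>An index on \<open>insert a A\<close> is its entry at \<open>a\<close> together with an index on \<open>A\<close>; extensionality
      forces the latter to be \<open>undefined\<close> at \<open>a\<close>.\<close>
  proof (rule sum.reindex_bij_witness[where j = "\<lambda>(k, u). u(a := k)" and i = "\<lambda>v. (v a, v(a := undefined))"])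
    fix p assume "p \<in> (SIGMA k:{..i}. ?P A (i - k))"
    then obtain k u where p: "p = (k, u)" and k: "k \<le> i" and u: "u \<in> extensional A" "sum u A = i - k" by auto
    have ua: "u a = undefined" using u(1) insert.hyps by (auto simp: extensional_def)
    show "(case p of (k, u) \<Rightarrow> u(a := k)) \<in> ?P (insert a A) i"
      using p k u insert.hyps upd(1)[of u k] by (auto simp: extensional_def)
    show "(\<lambda>v. (v a, v(a := undefined))) (case p of (k, u) \<Rightarrow> u(a := k)) = p"
      using p ua by auto
    show "(\<Prod>j\<in>insert a A. D ((case p of (k, u) \<Rightarrow> u(a := k)) j) (g j)) =
        (case p of (k, u) \<Rightarrow> D k (g a) * (\<Prod>j\<in>A. D (u j) (g j)))"
      using p insert.hyps upd(2)[of u k] by simp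
  next
    fix v assume v: "v \<in> ?P (insert a A) i"
    then have s: "v a + sum v A = i" using insert.hyps by simp
    show "(case (v a, v(a := undefined)) of (k, u) \<Rightarrow> u(a := k)) = v" by auto
    show "(v a, v(a := undefined)) \<in> (SIGMA k:{..i}. ?P A (i - k))"
      using v s upd(1)[of v undefined] by (auto simp: extensional_def)
  qed
  finally show ?case .
qed

lemma fps_power_cong_nth:
  fixes f g :: "'a::comm_semiring_1 fps"
  assumes "\<And>j. j \<le> n \<Longrightarrow> f $ j = g $ j"
  shows "j \<le> n \<Longrightarrow> (f ^ i) $ j = (g ^ i) $ j"
proof (induction i arbitrary: j)
  case (Suc i)
  then show ?case using assms by (auto simp: fps_mult_nth intro!: sum.cong)
qed simp

text \<open>
  Only the coefficients up to \<open>n\<close> matter, so \<open>f\<close> may be replaced by a finite sum of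
  monomials; the multinomial theorem then applies, and the term of \<open>u\<close> is a multiple of
  \<open>x\<close> to the power \<open>\<Sum> j u\<^sub>j\<close>. The bound \<open>u\<^sub>j \<le> i\<close> in the index set follows from
  \<open>\<Sum> u\<^sub>j = i\<close>.
\<close>

lemma fps_power_nth_U_idx:
  fixes f :: "'a::field_char_0 fps"
  assumes "f $ 0 = 0"
  shows "(f ^ i) $ n = (\<Sum>u\<in>U_idx n i. of_rat (B_coeff n i u) * (\<Prod>j=1..n. (f $ j) ^ u j))"
proof -
  define D where "D = (\<lambda>(k::nat) (F::'a fps). fps_const (1 / fact k) * F ^ k)"
  define g where "g = (\<lambda>j. fps_const (f $ j) * fps_X ^ j)"
  let ?P = "{u \<in> extensional {1..n}. sum u {1..n} = i}"
  have D_add: "D k (x + y) = (\<Sum>j\<le>k. D j x * D (k - j) y)" for k x y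
  proof -
    have "fps_const (1 / fact k) * (of_nat (k choose j) * x ^ j * y ^ (k - j)) =
        D j x * D (k - j) y" if "j \<le> k" for j
    proof -
      have "1 / fact k * of_nat (k choose j) = (1 / fact j * (1 / fact (k - j)) :: 'a)"
        using that by (simp add: binomial_fact)
      then have c: "fps_const (1 / fact k) * of_nat (k choose j) = (fps_const (1 / fact j) * fps_const (1 / fact (k - j)) :: 'a fps)"
        by (simp only: fps_of_nat[symmetric] fps_const_mult)
      have "fps_const (1 / fact k) * (of_nat (k choose j) * x ^ j * y ^ (k - j)) =
          fps_const (1 / fact k) * of_nat (k choose j) * (x ^ j * y ^ (k - j))"
        by (simp only: mult.assoc)
      then show ?thesis unfolding c D_def by (simp only: mult_ac)
    qed
    note product = this
    have "D k (x + y) = (\<Sum>j\<le>k. fps_const (1 / fact k) * (of_nat (k choose j) * x ^ j * y ^ (k - j)))"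
      unfolding D_def binomial_ring sum_distrib_left ..
    also have "\<dots> = (\<Sum>j\<le>k. D j x * D (k - j) y)"
      by (intro sum.cong refl product) simp
    finally show ?thesis .
  qed
  have D_0: "D k 0 = (if k = 0 then 1 else 0)" for k by (simp add: D_def)
  have const_prod: "(\<Prod>j\<in>J. fps_const (b j)) = (fps_const (\<Prod>j\<in>J. b j) :: 'a fps)" for b and J :: "nat set"
    by (induction J rule: infinite_finite_induct) simp_all
  have expand: "(\<Prod>j=1..n. D (u j) (g j)) =
      fps_const (\<Prod>j=1..n. (f $ j) ^ u j / fact (u j)) * fps_X ^ (\<Sum>j=1..n. j * u j)" for u
  proof -
    have "(\<Prod>j=1..n. D (u j) (g j)) = (\<Prod>j=1..n. fps_const ((f $ j) ^ u j / fact (u j)) * fps_X ^ (j * u j))"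
      by (simp add: D_def g_def power_mult_distrib fps_const_power power_mult flip: mult.assoc)
    also have "\<dots> = fps_const (\<Prod>j=1..n. (f $ j) ^ u j / fact (u j)) * fps_X ^ (\<Sum>j=1..n. j * u j)"
      by (simp add: prod.distrib const_prod power_sum)
    finally show ?thesis .
  qed
  have g_nth: "sum g {1..n} $ j = (if j \<in> {1..n} then f $ j else 0)" for j
  proof -
    have "sum g {1..n} $ j = (\<Sum>k=1..n. if k = j then f $ j else 0)"
      unfolding fps_sum_nth by (intro sum.cong) (auto simp: g_def)
    then show ?thesis by simp
  qed
  have "(f ^ i) $ n = (sum g {1..n} ^ i) $ n"
  proof (rule fps_power_cong_nth[of n])
    fix j assume "j \<le> n"
    then show "f $ j = sum g {1..n} $ j"
      unfolding g_nth using assms by (cases "j = 0") auto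
  qed simp
  also have "\<dots> = fact i * D i (sum g {1..n}) $ n"
    by (simp add: D_def)
  also have "D i (sum g {1..n}) = (\<Sum>u\<in>?P. \<Prod>j=1..n. D (u j) (g j))"
    by (rule divided_power_sum[OF D_add D_0]) simp
  also have "fact i * \<dots> $ n =
      (\<Sum>u\<in>?P. fact i * (if (\<Sum>j=1..n. j * u j) = n then (\<Prod>j=1..n. (f $ j) ^ u j / fact (u j)) else 0))"
    unfolding expand fps_sum_nth sum_distrib_left by (intro sum.cong) auto
  also have "\<dots> = (\<Sum>u\<in>U_idx n i. fact i * (\<Prod>j=1..n. (f $ j) ^ u j / fact (u j)))"
  proof (rule sum.mono_neutral_cong_right)
    show "finite ?P" by (rule finite_extensional_sum_eq) simp
    have "U_idx n i = {u \<in> ?P. (\<Sum>j=1..n. j * u j) = n}"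
      unfolding U_idx_def using PiE_bounded_by_sum_iff[of "{1..n}" _ i] by blast
    then show "U_idx n i \<subseteq> ?P"
      "\<forall>u\<in>?P - U_idx n i. fact i * (if (\<Sum>j=1..n. j * u j) = n then (\<Prod>j=1..n. (f $ j) ^ u j / fact (u j)) else 0) = 0"
      "\<And>u. u \<in> U_idx n i \<Longrightarrow> fact i * (if (\<Sum>j=1..n. j * u j) = n then (\<Prod>j=1..n. (f $ j) ^ u j / fact (u j)) else 0) =
         fact i * (\<Prod>j=1..n. (f $ j) ^ u j / fact (u j))"
      by auto
  qed
  also have "\<dots> = (\<Sum>u\<in>U_idx n i. of_rat (B_coeff n i u) * (\<Prod>j=1..n. (f $ j) ^ u j))"
  proof -
    have of_rat_fact: "of_rat (fact k) = (fact k :: 'a)" for k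
      by (metis of_nat_fact of_rat_of_nat_eq)
    show ?thesis by (simp add: B_coeff_def of_rat_divide of_rat_prod prod_dividef of_rat_fact)
  qed
  finally show ?thesis .
qed

text \<open>
  Write \<open>f - g = h x\<^sup>m\<close>. Then \<open>f\<^sup>i\<^sup>+\<^sup>1 - g\<^sup>i\<^sup>+\<^sup>1 = (f - g) \<Sum> f\<^sup>p g\<^sup>i\<^sup>-\<^sup>p\<close>, and each of the \<open>i + 1\<close>
  summands is \<open>x\<^sup>i\<close> times a series with constant coefficient \<open>(f $ 1)\<^sup>i\<close>. So a change of the
  coefficient at \<open>x\<^sup>m\<close> is first felt at \<open>x\<^sup>m\<^sup>+\<^sup>i\<close>, and there linearly. This linearisation
  gives uniqueness of solutions and isolates the unknown coefficient in the recursion for \<open>Q_pol\<close>.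
\<close>

lemma fps_power_nth_first_difference:
  fixes f g :: "'a::comm_ring_1 fps"
  assumes "f $ 0 = 0" "g $ 0 = 0" "m \<ge> 2" and agree: "\<And>j. j < m \<Longrightarrow> f $ j = g $ j"
  shows "n < m + i \<Longrightarrow> (f ^ Suc i) $ n = (g ^ Suc i) $ n"
    and "(f ^ Suc i) $ (m + i) - (g ^ Suc i) $ (m + i) = of_nat (Suc i) * (f $ 1) ^ i * (f $ m - g $ m)"
proof -
  define h where "h = fps_shift m (f - g)"
  have fX: "f = fps_shift 1 f * fps_X" and gX: "g = fps_shift 1 g * fps_X"
    using assms by (auto simp: fps_eq_iff)
  have h: "f - g = h * fps_X ^ m"
    unfolding h_def using agree by (auto simp: fps_eq_iff fps_X_power_mult_right_nth)
  \<comment> \<open>the cofactor of \<open>f - g\<close> with \<open>x\<^sup>i\<close> taken out\<close>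
  define S where "S = (\<Sum>p<Suc i. fps_shift 1 f ^ p * fps_shift 1 g ^ (i - p))"
  have "f ^ Suc i - g ^ Suc i = (f - g) * (\<Sum>p<Suc i. f ^ p * g ^ (i - p))"
    by (rule diff_power_eq_sum)
  also have "(\<Sum>p<Suc i. f ^ p * g ^ (i - p)) = S * fps_X ^ i"
    unfolding S_def sum_distrib_right
  proof (rule sum.cong)
    fix p assume "p \<in> {..<Suc i}"
    then have *: "fps_X ^ p * fps_X ^ (i - p) = (fps_X ^ i :: 'a fps)"
      by (simp flip: power_add)
    have "f ^ p * g ^ (i - p) = (fps_shift 1 f * fps_X) ^ p * (fps_shift 1 g * fps_X) ^ (i - p)"
      using fX gX by simp
    also have "\<dots> = fps_shift 1 f ^ p * fps_shift 1 g ^ (i - p) * (fps_X ^ p * fps_X ^ (i - p))"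
      by (simp only: power_mult_distrib mult_ac)
    finally show "f ^ p * g ^ (i - p) = fps_shift 1 f ^ p * fps_shift 1 g ^ (i - p) * fps_X ^ i"
      unfolding * .
  qed simp
  finally have eq: "f ^ Suc i - g ^ Suc i = h * S * fps_X ^ (m + i)"
    unfolding h by (simp only: power_add mult_ac)
  show "(f ^ Suc i) $ n = (g ^ Suc i) $ n" if "n < m + i"
    using arg_cong[OF eq, of "\<lambda>F. F $ n"] that by (simp only: fps_sub_nth fps_X_power_mult_right_nth) simp
  have "S $ 0 = of_nat (Suc i) * (f $ 1) ^ i"
  proof -
    have "S $ 0 = (\<Sum>p<Suc i. (f $ 1) ^ i)"
      unfolding S_def fps_sum_nth
    proof (rule sum.cong)
      fix p assume "p \<in> {..<Suc i}"
      then have "(f $ 1) ^ p * (f $ 1) ^ (i - p) = (f $ 1) ^ i"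
        by (simp flip: power_add)
      then show "(fps_shift 1 f ^ p * fps_shift 1 g ^ (i - p)) $ 0 = (f $ 1) ^ i"
        using agree[of 1] \<open>m \<ge> 2\<close> by (simp add: fps_mult_nth_0 fps_power_zeroth)
    qed simp
    then show ?thesis by (simp del: of_nat_Suc)
  qed
  then show "(f ^ Suc i) $ (m + i) - (g ^ Suc i) $ (m + i) =
      of_nat (Suc i) * (f $ 1) ^ i * (f $ m - g $ m)"
    using arg_cong[OF eq, of "\<lambda>F. F $ (m + i)"]
    by (simp only: fps_sub_nth fps_X_power_mult_right_nth fps_mult_nth_0)
       (simp add: h_def mult_ac del: power_Suc)
qed

lemma fps_power_nth_residue:
  fixes f :: "'a::comm_semiring_1 fps"
  assumes "\<And>m. f $ m \<noteq> 0 \<Longrightarrow> \<exists>j. m = j * l + 1"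
  shows "(f ^ i) $ n \<noteq> 0 \<Longrightarrow> \<exists>j. n = j * l + i"
proof (induction i arbitrary: n)
  case 0
  then show ?case by (auto intro: exI[of _ 0] split: if_splits)
next
  case (Suc i)
  have "\<exists>p\<in>{0..n}. f $ p * (f ^ i) $ (n - p) \<noteq> 0"
    using Suc.prems by (auto simp: fps_mult_nth intro: sum.neutral)
  then obtain p where p: "p \<le> n" "f $ p \<noteq> 0" "(f ^ i) $ (n - p) \<noteq> 0"
    by (metis atLeastAtMost_iff mult_zero_left mult_zero_right)
  obtain a b where "p = a * l + 1" "n - p = b * l + i" using assms[OF p(2)] Suc.IH[OF p(3)] by auto
  with p(1) have "n = (a + b) * l + Suc i" by (simp add: algebra_simps)
  then show ?case by blast
qed

lemma mod_eq_one_mod_iff: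
  fixes j l :: nat
  assumes "j \<ge> 1"
  shows "j mod l = 1 mod l \<longleftrightarrow> (\<exists>p. j = p * l + 1)"
proof -
  have "j mod l = 1 mod l \<longleftrightarrow> l dvd j - 1"
    using mod_eq_dvd_iff_nat[OF assms] .
  also have "\<dots> \<longleftrightarrow> (\<exists>p. j = p * l + 1)"
  proof
    assume "l dvd j - 1"
    then obtain p where "j - 1 = l * p" ..
    with assms have "j = p * l + 1" by (simp add: mult.commute)
    then show "\<exists>p. j = p * l + 1" ..
  qed auto
  finally show ?thesis .
qed

text \<open>
  For a series in which only exponents \<open>jl + 1\<close> occur, every index outside \<open>U_res\<close> contributes
  a vanishing factor. That \<open>u\<^sub>j = 0\<close> for \<open>j > n - i + 1\<close> is automatic, because
  \<open>\<Sum> (j - 1) u\<^sub>j = n - i\<close>. As \<open>f $ 1 = 1\<close>, the entry \<open>u\<^sub>1\<close> leaves no trace in the product.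
\<close>

lemma fps_power_nth_U_res:
  fixes f :: "'a::field_char_0 fps"
  assumes "l \<ge> 1" and supp: "\<And>m. f $ m \<noteq> 0 \<Longrightarrow> \<exists>j. m = j * l + 1" and "f $ 1 = 1"
    and "i \<ge> 1" and n: "n = s * l + i"
  shows "(f ^ i) $ n = (\<Sum>u\<in>U_res l n i. of_rat (B_coeff n i u) * (\<Prod>j=1..s. (f $ (j * l + 1)) ^ u (j * l + 1)))"
proof -
  have f0: "f $ 0 = 0" using supp[of 0] by auto
  have small: "u j = 0" if u: "u \<in> U_idx n i" and j: "j \<in> {n - i + 2..n}" for u j
  proof (rule ccontr)
    assume "u j \<noteq> 0"
    then have "j - 1 \<le> (j - 1) * u j" by simp
    also have "\<dots> \<le> (\<Sum>k=1..n. (k - 1) * u k)"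
      using j by (intro member_le_sum) auto
    finally have le: "j - 1 \<le> (\<Sum>k=1..n. (k - 1) * u k)" .
    \<comment> \<open>The two constraints on \<open>u\<close> combine to \<open>\<Sum> (k - 1) u\<^sub>k = n - i\<close>.\<close>
    have "(\<Sum>k=1..n. (k - 1) * u k) + (\<Sum>k=1..n. u k) = (\<Sum>k=1..n. k * u k)"
      unfolding sum.distrib[symmetric] by (intro sum.cong) (auto simp: algebra_simps diff_mult_distrib)
    then have "(\<Sum>k=1..n. (k - 1) * u k) + i = n"
      using u by (simp add: U_idx_def)
    then show False using le j by auto
  qed
  have "(f ^ i) $ n = (\<Sum>u\<in>U_idx n i. of_rat (B_coeff n i u) * (\<Prod>j=1..n. (f $ j) ^ u j))"
    by (rule fps_power_nth_U_idx[of _ i n, OF f0])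
  also have "\<dots> = (\<Sum>u\<in>U_res l n i. of_rat (B_coeff n i u) * (\<Prod>j=1..s. (f $ (j * l + 1)) ^ u (j * l + 1)))"
  proof (rule sum.mono_neutral_cong_right)
    have "U_idx n i \<subseteq> {1..n} \<rightarrow>\<^sub>E {0..i}" by (auto simp: U_idx_def)
    then show "finite (U_idx n i)" by (rule finite_subset) (auto intro: finite_PiE)
    show "U_res l n i \<subseteq> U_idx n i" by (auto simp: U_res_def)
    \<comment> \<open>An index outside \<open>U_res\<close> uses an exponent at which \<open>f\<close> vanishes.\<close>
    show "\<forall>u\<in>U_idx n i - U_res l n i. of_rat (B_coeff n i u) * (\<Prod>j=1..n. (f $ j) ^ u j) = 0"
    proof
      fix u assume u: "u \<in> U_idx n i - U_res l n i"
      then obtain j where j: "j \<in> {2..n - i + 1}" "j mod l \<noteq> 1 mod l" "u j \<noteq> 0"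
        using small[of u] by (auto simp: U_res_def)
      have "f $ j = 0" using supp[of j] mod_eq_one_mod_iff[of j l] j by auto
      then have "(f $ j) ^ u j = 0" using j by simp
      moreover have "j \<in> {1..n}" using j n \<open>i \<ge> 1\<close> by auto
      ultimately have "(\<Prod>j=1..n. (f $ j) ^ u j) = 0" by (meson finite_atLeastAtMost prod_zero)
      then show "of_rat (B_coeff n i u) * (\<Prod>j=1..n. (f $ j) ^ u j) = 0" by simp
    qed
  next
    fix u assume u: "u \<in> U_res l n i"
    have "(\<Prod>j=1..n. (f $ j) ^ u j) = (\<Prod>j\<in>(\<lambda>j. j * l + 1) ` {1..s}. (f $ j) ^ u j)"
    proof (rule prod.mono_neutral_right)
      show "(\<lambda>j. j * l + 1) ` {1..s} \<subseteq> {1..n}"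
      proof (rule image_subsetI)
        fix j assume "j \<in> {1..s}"
        then have "j * l \<le> s * l" by (intro mult_le_mono1) simp
        with n \<open>i \<ge> 1\<close> have "j * l + 1 \<le> n" by linarith
        then show "j * l + 1 \<in> {1..n}" by simp
      qed
      show "\<forall>j\<in>{1..n} - (\<lambda>j. j * l + 1) ` {1..s}. (f $ j) ^ u j = 1"
      proof
        fix j assume j: "j \<in> {1..n} - (\<lambda>j. j * l + 1) ` {1..s}"
        consider "j = 1" | "j \<in> {2..n - i + 1}" | "j \<in> {n - i + 2..n}" using j by force
        then show "(f $ j) ^ u j = 1"
        proof cases
          case 2
          have "j mod l \<noteq> 1 mod l"
          proof
            assume "j mod l = 1 mod l"
            then obtain p where p: "j = p * l + 1" using mod_eq_one_mod_iff[of j l] 2 by auto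
            with 2 n have "p * l \<le> s * l" "p \<noteq> 0" by auto
            with \<open>l \<ge> 1\<close> have "p \<in> {1..s}" by auto
            with j p show False by blast
          qed
          with u 2 have "u j = 0" by (simp only: U_res_def) blast
          then show ?thesis by simp
        qed (use assms(3) u in \<open>auto simp: U_res_def\<close>)
      qed
    qed simp
    also have "\<dots> = (\<Prod>j=1..s. (f $ (j * l + 1)) ^ u (j * l + 1))"
      using \<open>l \<ge> 1\<close> by (subst prod.reindex) (auto simp: inj_on_def)
    finally show "of_rat (B_coeff n i u) * (\<Prod>j=1..n. (f $ j) ^ u j) =
        of_rat (B_coeff n i u) * (\<Prod>j=1..s. (f $ (j * l + 1)) ^ u (j * l + 1))" by simp
  qed
  finally show ?thesis .
qed

section \<open>Evaluation of the universal polynomials\<close>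

lemma map_poly_add_hom:
  assumes "h 0 = 0" "\<And>a b. h (a + b) = h a + h b"
  shows "map_poly h (p + q) = map_poly h p + map_poly h q"
  by (rule poly_eqI) (simp add: coeff_map_poly assms)

lemma map_poly_mult_hom:
  fixes h :: "'b::comm_semiring_0 \<Rightarrow> 'c::comm_semiring_0"
  assumes "h 0 = 0" "\<And>a b. h (a + b) = h a + h b" "\<And>a b. h (a * b) = h a * h b"
  shows "map_poly h (p * q) = map_poly h p * map_poly h q"
proof (induction p)
  case (pCons a p)
  have "map_poly h (smult a q) = smult (h a) (map_poly h q)"
    by (rule poly_eqI) (simp add: coeff_map_poly assms)
  with pCons show ?case
    by (simp add: map_poly_pCons map_poly_add_hom assms)
qed simp

text \<open>
  \<open>eval2\<close> is an evaluation of a polynomial whose coefficients were first evaluated by the map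
  \<open>h\<close> below; both steps are ring homomorphisms, whence so is \<open>eval2\<close>.
\<close>

lemma eval2_inner_hom:
  fixes d :: "'a::field_char_0"
  defines "h \<equiv> \<lambda>p. poly (map_poly of_rat p) d"
  shows "h 0 = 0" "h (p + q) = h p + h q" "h (p * q) = h p * h q"
  by (simp_all add: h_def map_poly_add_hom map_poly_mult_hom of_rat_add of_rat_mult)

lemma eval2_0 [simp]: "eval2 0 c d = 0"
  and eval2_1 [simp]: "eval2 1 c d = 1"
  and eval2_add: "eval2 (P + Q) c d = eval2 P c d + eval2 Q c d"
  and eval2_mult: "eval2 (P * Q) c d = eval2 P c d * eval2 Q c d"
  by (simp_all add: eval2_def map_poly_add_hom map_poly_mult_hom eval2_inner_hom)

lemma eval2_diff: "eval2 (P - Q) c d = eval2 P c d - eval2 Q c d"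
  using eval2_add[of "P - Q" Q c d] by simp

lemma eval2_power: "eval2 (P ^ n) c d = eval2 P c d ^ n"
  by (induction n) (simp_all add: eval2_mult)

lemma eval2_of_nat: "eval2 (of_nat n) c d = of_nat n"
  by (induction n) (simp_all add: eval2_add)

lemma eval2_sum: "eval2 (\<Sum>x\<in>A. P x) c d = (\<Sum>x\<in>A. eval2 (P x) c d)"
  by (induction A rule: infinite_finite_induct) (simp_all add: eval2_add)

lemma eval2_prod: "eval2 (\<Prod>x\<in>A. P x) c d = (\<Prod>x\<in>A. eval2 (P x) c d)"
  by (induction A rule: infinite_finite_induct) (simp_all add: eval2_mult)

lemma eval2_scal2: "eval2 (scal2 a) c d = of_rat a"
  and eval2_var_y: "eval2 var_y c d = c"
  and eval2_var_t: "eval2 var_t c d = d"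
  by (simp_all add: eval2_def map_poly_pCons)

lemmas eval2_simps = eval2_add eval2_mult eval2_diff eval2_power eval2_of_nat eval2_sum eval2_prod
  eval2_scal2 eval2_var_y eval2_var_t

lemma eval2_Q_pol_1: "eval2 (Q_pol l 1) c d = c"
  by (simp add: Q_pol.simps eval2_var_y)

lemma eval2_Q_pol_rec:
  fixes c d :: "'a::field_char_0"
  assumes "r \<ge> 2" "l \<ge> 1"
  defines "q \<equiv> \<lambda>j. eval2 (Q_pol l j) c d" and "n \<equiv> (r + 1) * l + 1"
  shows "of_nat ((r - 1) * l) * q r =
     (\<Sum>u\<in>U_check l n. of_rat (B_coeff n (l + 1) u) * (\<Prod>j=1..r-1. q j ^ u (j * l + 1)))
     + d * (\<Sum>u\<in>U_res l n (2 * l + 1). of_rat (B_coeff n (2 * l + 1) u) * (\<Prod>j=1..r-1. q j ^ u (j * l + 1)))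
     - d * of_nat ((r - 1) * l + 1) * q (r - 1)"
proof -
  have nz: "(of_nat ((r - 1) * l) :: 'a) \<noteq> 0" using assms(1,2) unfolding of_nat_eq_0_iff by simp
  have "\<not> r = 0" "\<not> r = 1" using assms(1) by auto
  then have Q: "Q_pol l r = scal2 (1 / of_nat ((r - 1) * l)) *
         ((\<Sum>u\<in>U_check l n. scal2 (B_coeff n (l + 1) u) * (\<Prod>j=1..r-1. Q_pol l j ^ u (j * l + 1)))
          + var_t * (\<Sum>u\<in>U_res l n (2 * l + 1).
              scal2 (B_coeff n (2 * l + 1) u) * (\<Prod>j=1..r-1. Q_pol l j ^ u (j * l + 1)))
          - var_t * of_nat ((r - 1) * l + 1) * Q_pol l (r - 1))"
    by (subst Q_pol.simps) (simp only: if_False Let_def n_def)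
  have "of_rat (1 / of_nat ((r - 1) * l)) = (1 / of_nat ((r - 1) * l) :: 'a)"
    by (simp only: of_rat_divide of_rat_of_nat_eq of_rat_1)
  with nz show ?thesis
    unfolding q_def Q eval2_simps by (simp del: of_nat_mult of_nat_Suc of_nat_add)
qed

section \<open>Substitution and changes of variable\<close>

lemma mem_Gamma_inf [simp]: "f \<in> carrier Gamma_inf \<longleftrightarrow> f $ 0 = 0 \<and> f $ 1 \<noteq> 0"
  by (simp add: Gamma_inf_def)

lemma mult_Gamma_inf [simp]: "f \<otimes>\<^bsub>Gamma_inf\<^esub> g = f oo g"
  by (simp add: Gamma_inf_def)

lemma one_Gamma_inf [simp]: "\<one>\<^bsub>Gamma_inf\<^esub> = fps_X"
  by (simp add: Gamma_inf_def)

lemma fps_compose_nth_1: "(f oo g) $ 1 = f $ 1 * g $ 1"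
  by (simp add: fps_compose_nth)

lemma fps_inv_nth_0: "fps_inv f $ 0 = 0"
  and fps_inv_nth_1: "fps_inv f $ 1 = inverse (f $ 1)"
  by (simp_all add: fps_inv_def inverse_eq_divide)

lemma group_Gamma_inf: "group (Gamma_inf :: 'a::field fps monoid)"
proof (rule groupI)
  fix f g h :: "'a fps"
  assume "f \<in> carrier Gamma_inf" "g \<in> carrier Gamma_inf" "h \<in> carrier Gamma_inf"
  then show "f \<otimes>\<^bsub>Gamma_inf\<^esub> g \<otimes>\<^bsub>Gamma_inf\<^esub> h = f \<otimes>\<^bsub>Gamma_inf\<^esub> (g \<otimes>\<^bsub>Gamma_inf\<^esub> h)"
    by (simp add: fps_compose_assoc)
next
  fix f :: "'a fps"
  assume "f \<in> carrier Gamma_inf"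
  then show "\<exists>g\<in>carrier Gamma_inf. g \<otimes>\<^bsub>Gamma_inf\<^esub> f = \<one>\<^bsub>Gamma_inf\<^esub>"
    by (intro bexI[of _ "fps_inv f"])
       (auto simp: fps_inv fps_inv_nth_0 fps_inv_nth_1 simp del: One_nat_def)
qed (auto simp: fps_compose_nth_1 simp del: One_nat_def)

lemma inv_Gamma_inf:
  fixes f :: "'a::field fps"
  assumes "f \<in> carrier Gamma_inf"
  shows "inv\<^bsub>Gamma_inf\<^esub> f = fps_inv f"
  using assms by (intro group.inv_equality[OF group_Gamma_inf])
    (auto simp: fps_inv fps_inv_nth_0 fps_inv_nth_1 simp del: One_nat_def)

text \<open>
  One relation covers both notions of the theory: \<open>AJ_change H T H'\<close> is the equation defining a
  transformation \<open>T\<close> of the equation for \<open>H\<close> into the one for \<open>H'\<close>, cleared of the inverse of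
  \<open>T'\<close>, and the solutions of the equation for \<open>H\<close> are its changes into itself. By the chain rule
  changes compose and can be inverted, which yields at once that the solutions form a group and
  that conjugation with \<open>T\<close> identifies the solution groups of \<open>H'\<close> and \<open>H\<close>.
\<close>

definition AJ_change :: "'a::field fps \<Rightarrow> 'a fps \<Rightarrow> 'a fps \<Rightarrow> bool" where
  "AJ_change H T H' \<longleftrightarrow> T \<in> carrier Gamma_inf \<and> (H oo T) = fps_deriv T * H'"

lemma AJ_sol_iff_change: "\<Phi> \<in> AJ_sol H \<longleftrightarrow> AJ_change H \<Phi> H"
  by (simp add: AJ_sol_def AJ_change_def)

lemma AJ_change_id: "AJ_change H fps_X H"
  by (simp add: AJ_change_def)

lemma AJ_change_comp:
  assumes "AJ_change H S H'" "AJ_change H' R H''"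
  shows "AJ_change H (S oo R) H''"
proof -
  have S: "S $ 0 = 0" "S $ 1 \<noteq> 0" "(H oo S) = fps_deriv S * H'"
    and R: "R $ 0 = 0" "R $ 1 \<noteq> 0" "(H' oo R) = fps_deriv R * H''"
    using assms by (auto simp: AJ_change_def)
  have "H oo (S oo R) = (H oo S) oo R"
    using S(1) R(1) by (simp add: fps_compose_assoc)
  also have "\<dots> = (fps_deriv S oo R) * (fps_deriv R * H'')"
    unfolding S(3) fps_compose_mult_distrib[OF R(1)] R(3) ..
  finally show ?thesis
    using S(1,2) R(1,2) fps_compose_nth_1[of S R]
    by (simp add: AJ_change_def fps_compose_deriv mult.assoc)
qed

lemma AJ_change_inv:
  assumes "AJ_change H S H'"
  shows "AJ_change H' (fps_inv S) H"
proof -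
  let ?R = "fps_inv S"
  have S: "S $ 0 = 0" "S $ 1 \<noteq> 0" "(H oo S) = fps_deriv S * H'"
    using assms by (auto simp: AJ_change_def)
  have R0: "?R $ 0 = 0" by (rule fps_inv_nth_0)
  have SR: "S oo ?R = fps_X" by (rule fps_inv_right[OF S(1,2)])
  have "fps_deriv (S oo ?R) = (fps_deriv S oo ?R) * fps_deriv ?R"
    by (rule fps_compose_deriv[OF R0])
  then have d: "(fps_deriv S oo ?R) * fps_deriv ?R = 1"
    by (simp add: SR)
  have "H = H oo (S oo ?R)" by (simp add: SR)
  also have "\<dots> = (H oo S) oo ?R" by (rule fps_compose_assoc[OF R0 S(1)])
  also have "\<dots> = (fps_deriv S oo ?R) * (H' oo ?R)"
    unfolding S(3) by (rule fps_compose_mult_distrib[OF R0])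
  finally have "fps_deriv ?R * H = ((fps_deriv S oo ?R) * fps_deriv ?R) * (H' oo ?R)"
    by (simp add: mult_ac)
  then show ?thesis
    using d R0 S(2) fps_inv_nth_1[of S] by (simp add: AJ_change_def)
qed

lemma AJ_change_if_transforms:
  assumes "transforms_AJ T H H'"
  shows "AJ_change H T H'"
proof -
  have T: "T $ 0 = 0" "T $ 1 = 1" "H' = inverse (fps_deriv T) * (H oo T)"
    using assms by (auto simp: transforms_AJ_def Gamma1_inf_def)
  have "fps_deriv T * inverse (fps_deriv T) = 1"
    using T(2) by (intro inverse_mult_eq_1') simp
  then have "fps_deriv T * H' = (H oo T)"
    unfolding T(3) by (simp flip: mult.assoc)
  then show ?thesis using T(1,2) by (simp add: AJ_change_def)
qed

lemma subgroup_AJ_sol: "subgroup (AJ_sol H) (Gamma_inf :: 'a::field fps monoid)"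
proof
  show "AJ_sol H \<subseteq> carrier Gamma_inf" by (auto simp: AJ_sol_def)
qed (auto simp: AJ_sol_iff_change AJ_change_id intro: AJ_change_comp,
     metis AJ_change_def AJ_change_inv inv_Gamma_inf)

lemma AJ_group_simps [simp]:
  "carrier (AJ_group H) = AJ_sol H" "f \<otimes>\<^bsub>AJ_group H\<^esub> g = f oo g" "\<one>\<^bsub>AJ_group H\<^esub> = fps_X"
  by (simp_all add: AJ_group_def Gamma_inf_def)

lemma group_AJ_group: "group (AJ_group H)"
  unfolding AJ_group_def by (rule group.subgroup_imp_group[OF group_Gamma_inf subgroup_AJ_sol])

lemma inv_AJ_group:
  assumes "f \<in> AJ_sol H"
  shows "inv\<^bsub>AJ_group H\<^esub> f = fps_inv f"
proof (rule group.inv_equality[OF group_AJ_group])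
  show "fps_inv f \<otimes>\<^bsub>AJ_group H\<^esub> f = \<one>\<^bsub>AJ_group H\<^esub>"
    using assms by (simp add: AJ_sol_def fps_inv)
qed (use assms in \<open>auto simp: AJ_sol_iff_change intro: AJ_change_inv\<close>)

lemma conj_T_eq:
  fixes T F :: "'a::field fps"
  assumes "T \<in> carrier Gamma_inf"
  shows "conj_T T F = T \<otimes>\<^bsub>Gamma_inf\<^esub> F \<otimes>\<^bsub>Gamma_inf\<^esub> inv\<^bsub>Gamma_inf\<^esub> T"
  using assms by (simp add: conj_T_def inv_Gamma_inf del: mem_Gamma_inf)

text \<open>
  If \<open>\<Phi>\<close> changes \<open>H'\<close> into itself, then \<open>T\<close>, \<open>\<Phi>\<close> and the inverse of \<open>T\<close> are three composable changes
  leading from \<open>H\<close> back to \<open>H\<close>. The relation is symmetric under inversion, so conjugation with the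
  inverse of \<open>T\<close> undoes this.
\<close>

lemma conj_T_iso:
  fixes T :: "'a::field fps"
  assumes "AJ_change H T H'"
  shows "conj_T T \<in> iso (AJ_group H') (AJ_group H)"
proof -
  interpret \<Gamma>: group "Gamma_inf :: 'a fps monoid" by (rule group_Gamma_inf)
  have T: "T \<in> carrier Gamma_inf" using assms by (simp add: AJ_change_def)
  have fT: "fps_inv T \<in> carrier Gamma_inf" using \<Gamma>.inv_closed[OF T] inv_Gamma_inf[OF T] by simp
  have mem: "F \<in> carrier Gamma_inf" if "F \<in> AJ_sol K" for F K :: "'a fps"
    using that subgroup.subset[OF subgroup_AJ_sol] by blast
  have closed: "conj_T R F \<in> AJ_sol K" if "AJ_change K R K'" "F \<in> AJ_sol K'" for R F K K' :: "'a fps"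
    using that unfolding conj_T_def AJ_sol_iff_change by (blast intro: AJ_change_comp AJ_change_inv)
  have cancel: "inv\<^bsub>Gamma_inf\<^esub> R \<otimes>\<^bsub>Gamma_inf\<^esub> (R \<otimes>\<^bsub>Gamma_inf\<^esub> F) = F"
      "R \<otimes>\<^bsub>Gamma_inf\<^esub> (inv\<^bsub>Gamma_inf\<^esub> R \<otimes>\<^bsub>Gamma_inf\<^esub> F) = F"
    if "R \<in> carrier Gamma_inf" "F \<in> carrier Gamma_inf" for R F :: "'a fps"
    using that \<Gamma>.m_assoc[of "inv\<^bsub>Gamma_inf\<^esub> R" R F] \<Gamma>.m_assoc[of R "inv\<^bsub>Gamma_inf\<^esub> R" F]
    by (simp_all del: mult_Gamma_inf mem_Gamma_inf one_Gamma_inf)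
  have mult: "conj_T T (F oo G) = conj_T T F oo conj_T T G"
    if "F \<in> carrier Gamma_inf" "G \<in> carrier Gamma_inf" for F G
  proof -
    have "conj_T T (F \<otimes>\<^bsub>Gamma_inf\<^esub> G) = conj_T T F \<otimes>\<^bsub>Gamma_inf\<^esub> conj_T T G"
      unfolding conj_T_eq[OF T] using that T
      by (simp add: \<Gamma>.m_assoc cancel del: mult_Gamma_inf mem_Gamma_inf)
    then show ?thesis by simp
  qed
  have inverse: "conj_T R (conj_T (fps_inv R) F) = F"
    if "R \<in> carrier Gamma_inf" "fps_inv R \<in> carrier Gamma_inf" "F \<in> carrier Gamma_inf" for R F :: "'a fps"
  proof -
    have i: "inv\<^bsub>Gamma_inf\<^esub> R = fps_inv R" "inv\<^bsub>Gamma_inf\<^esub> (fps_inv R) = R"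
      using that(1) by (metis inv_Gamma_inf \<Gamma>.inv_inv)+
    show ?thesis
      unfolding conj_T_eq[OF that(1)] conj_T_eq[OF that(2)] i using that
      by (simp add: \<Gamma>.m_assoc cancel flip: i(1) del: mult_Gamma_inf mem_Gamma_inf one_Gamma_inf)
  qed
  have inverse': "conj_T (fps_inv T) (conj_T T F) = F" if "F \<in> carrier Gamma_inf" for F
    using inverse[of "fps_inv T" F] that T fT fps_inv_idempotent[of T] by simp
  show ?thesis
  proof (rule isoI)
    show "conj_T T \<in> hom (AJ_group H') (AJ_group H)"
      using closed[OF assms] mult mem by (intro homI) (simp_all del: mem_Gamma_inf)
    show "bij_betw (conj_T T) (carrier (AJ_group H')) (carrier (AJ_group H))"
      using closed[OF assms] closed[OF AJ_change_inv[OF assms]] inverse[OF T fT] inverse' mem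
      by (intro bij_betw_byWitness[where f' = "conj_T (fps_inv T)"]) (auto simp del: mem_Gamma_inf)
  qed
qed

lemma internal_direct_product_iso_image:
  assumes "group G" "group K" and h: "h \<in> iso G K" and AB: "internal_direct_product G A B"
  shows "internal_direct_product K (h ` A) (h ` B)"
proof -
  interpret h: group_hom G K h
    using assms by (simp add: group_hom_def group_hom_axioms_def iso_def)
  have bij: "bij_betw h (carrier G) (carrier K)" using h by (simp add: iso_def)
  have norm: "normal (h ` N) K" if "normal N G" for N
  proof -
    have N: "subgroup N G" and c: "\<And>x n. x \<in> carrier G \<Longrightarrow> n \<in> N \<Longrightarrow> x \<otimes>\<^bsub>G\<^esub> n \<otimes>\<^bsub>G\<^esub> inv\<^bsub>G\<^esub> x \<in> N"
      using that by (auto simp: h.G.normal_inv_iff)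
    have "y \<otimes>\<^bsub>K\<^esub> h n \<otimes>\<^bsub>K\<^esub> inv\<^bsub>K\<^esub> y \<in> h ` N" if y: "y \<in> carrier K" and n: "n \<in> N" for y n
    proof -
      obtain x where x: "x \<in> carrier G" "y = h x" using y bij unfolding bij_betw_def by blast
      have "n \<in> carrier G" using n subgroup.subset[OF N] by blast
      then have "y \<otimes>\<^bsub>K\<^esub> h n \<otimes>\<^bsub>K\<^esub> inv\<^bsub>K\<^esub> y = h (x \<otimes>\<^bsub>G\<^esub> n \<otimes>\<^bsub>G\<^esub> inv\<^bsub>G\<^esub> x)"
        using x by simp
      then show ?thesis using c[OF x(1) n] by blast
    qed
    then show ?thesis
      using h.subgroup_img_is_subgroup[OF N] by (auto simp: h.H.normal_inv_iff)
  qed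
  have nA: "normal A G" and nB: "normal B G" and int: "A \<inter> B = {\<one>\<^bsub>G\<^esub>}" and mult: "A <#>\<^bsub>G\<^esub> B = carrier G"
    using AB by (auto simp: internal_direct_product_def)
  have sub: "A \<subseteq> carrier G" "B \<subseteq> carrier G"
    using nA nB by (auto dest: normal_imp_subgroup subgroup.subset)
  have "h ` A \<inter> h ` B = h ` (A \<inter> B)"
    using inj_on_image_Int[OF bij_betw_imp_inj_on[OF bij] sub] by simp
  moreover have "h ` A <#>\<^bsub>K\<^esub> h ` B = h ` (A <#>\<^bsub>G\<^esub> B)"
    using sub by (rule set_mult_hom[symmetric, OF h.homh])
  ultimately show ?thesis
    using norm[OF nA] norm[OF nB] bij int mult by (simp add: internal_direct_product_def bij_betw_def)
qed

section \<open>Solutions of the equation in normal form\<close>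

definition AJ_normal_form :: "nat \<Rightarrow> 'a::field \<Rightarrow> 'a fps" where
  "AJ_normal_form l \<delta> = fps_X ^ (l + 1) + fps_const \<delta> * fps_X ^ (2 * l + 1)"

text \<open>
  Comparison of coefficients at \<open>x\<^sup>m\<^sup>+\<^sup>l\<close>. Natural number subtraction is harmless on the right: for
  \<open>m \<le> l\<close> the factor \<open>of_nat (m - l)\<close> is zero, as it should be.
\<close>

lemma AJ_normal_form_sol_iff:
  fixes \<Phi> :: "'a::field fps"
  assumes "\<Phi> \<in> carrier Gamma_inf"
  shows "\<Phi> \<in> AJ_sol (AJ_normal_form l \<delta>) \<longleftrightarrow>
    (\<forall>m\<ge>1. (\<Phi> ^ Suc l) $ (m + l) + \<delta> * (\<Phi> ^ Suc (2 * l)) $ (m + l) =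
       of_nat m * \<Phi> $ m + \<delta> * (of_nat (m - l) * \<Phi> $ (m - l)))" (is "_ \<longleftrightarrow> (\<forall>m\<ge>1. ?L m = ?R m)")
proof -
  let ?H = "AJ_normal_form l \<delta>"
  have \<Phi>0: "\<Phi> $ 0 = 0" using assms by simp
  have "(?H oo \<Phi>) = \<Phi> ^ Suc l + fps_const \<delta> * \<Phi> ^ Suc (2 * l)"
    unfolding AJ_normal_form_def
    by (simp add: fps_compose_add_distrib fps_compose_mult_distrib[OF \<Phi>0] fps_X_power_compose[OF \<Phi>0] del: power_Suc)
  then have L: "(?H oo \<Phi>) $ n = (\<Phi> ^ Suc l) $ n + \<delta> * (\<Phi> ^ Suc (2 * l)) $ n" for n
    by (simp del: power_Suc)
  have "fps_deriv \<Phi> * ?H = fps_deriv \<Phi> * fps_X ^ (l + 1) + fps_const \<delta> * (fps_deriv \<Phi> * fps_X ^ (2 * l + 1))"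
    unfolding AJ_normal_form_def by (simp only: distrib_left mult_ac)
  then have R: "(fps_deriv \<Phi> * ?H) $ n =
      (if n < l + 1 then 0 else of_nat (n - l) * \<Phi> $ (n - l)) +
      \<delta> * (if n < 2 * l + 1 then 0 else of_nat (n - 2 * l) * \<Phi> $ (n - 2 * l))" for n
    by (simp only: fps_add_nth fps_mult_left_const_nth fps_X_power_mult_right_nth fps_deriv_nth)
       (auto simp: Suc_diff_Suc simp del: of_nat_Suc)
  have "((?H oo \<Phi>) $ n = (fps_deriv \<Phi> * ?H) $ n) \<longleftrightarrow> (n > l \<longrightarrow> ?L (n - l) = ?R (n - l))" for n
  proof (cases "n > l")
    case True
    have "n - l + l = n" "n - l - l = n - 2 * l" "\<not> n < l + 1" using True by simp_all
    moreover have "(if n < 2 * l + 1 then 0 else of_nat (n - 2 * l) * \<Phi> $ (n - 2 * l)) =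
        of_nat (n - 2 * l) * \<Phi> $ (n - 2 * l)" by simp
    ultimately show ?thesis
      unfolding L R using True by (simp only: if_False simp_thms)
  next
    case False
    then show ?thesis
      unfolding L R using startsby_zero_power_prefix[OF \<Phi>0, of "Suc l"] startsby_zero_power_prefix[OF \<Phi>0, of "Suc (2 * l)"]
      by (simp del: power_Suc)
  qed
  then have "(?H oo \<Phi>) = fps_deriv \<Phi> * ?H \<longleftrightarrow> (\<forall>n. n > l \<longrightarrow> ?L (n - l) = ?R (n - l))"
    by (simp add: fps_eq_iff del: power_Suc)
  also have "\<dots> \<longleftrightarrow> (\<forall>m\<ge>1. ?L m = ?R m)"
  proof (intro iffI allI impI)
    fix m :: nat assume *: "\<forall>n. n > l \<longrightarrow> ?L (n - l) = ?R (n - l)" and "m \<ge> 1"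
    then show "?L m = ?R m" using *[rule_format, of "m + l"] by (simp del: power_Suc)
  next
    fix n assume *: "\<forall>m\<ge>1. ?L m = ?R m" and "n > l"
    then show "?L (n - l) = ?R (n - l)" by (metis Suc_leI One_nat_def zero_less_diff)
  qed
  finally show ?thesis using assms by (simp add: AJ_sol_def)
qed

lemma AJ_normal_form_sol_nth_1:
  assumes "l \<ge> 1" "\<Phi> \<in> AJ_sol (AJ_normal_form l \<delta>)"
  shows "\<Phi> $ 1 \<in> E_roots l"
proof -
  have c: "\<Phi> \<in> carrier Gamma_inf" using assms(2) by (simp add: AJ_sol_def)
  then have \<Phi>: "\<Phi> $ 0 = 0" "\<Phi> $ 1 \<noteq> 0" by simp_all
  have "(\<Phi> ^ Suc l) $ (1 + l) = (\<Phi> $ 1) ^ Suc l" "(\<Phi> ^ Suc (2 * l)) $ (1 + l) = 0"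
    using startsby_zero_power_nth_same[OF \<Phi>(1), of "Suc l"]
      startsby_zero_power_prefix[OF \<Phi>(1), of "Suc (2 * l)"] assms(1)
    by (simp_all del: power_Suc)
  then have "(\<Phi> $ 1) ^ Suc l = \<Phi> $ 1"
    using AJ_normal_form_sol_iff[OF c, of l \<delta>] assms by (auto simp del: power_Suc dest!: spec[of _ 1])
  then show ?thesis using \<Phi>(2) by (simp add: E_roots_def)
qed

text \<open>
  If two solutions agree below \<open>x\<^sup>m\<close>, linearisation turns the equation at \<open>x\<^sup>m\<^sup>+\<^sup>l\<close> into
  \<open>(l + 1) c\<^sub>1\<^sup>l d = m d\<close> for the difference \<open>d\<close> of their coefficients at \<open>x\<^sup>m\<close>; the terms with
  \<open>\<delta>\<close> only involve earlier coefficients. Since \<open>c\<^sub>1\<^sup>l = 1\<close> and the characteristic is zero, \<open>d = 0\<close>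
  unless \<open>m = l + 1\<close>, which is the one coefficient that remains free.
\<close>

lemma AJ_normal_form_sol_unique:
  fixes \<Phi> \<Psi> :: "'a::field_char_0 fps"
  assumes "l \<ge> 1" and sol: "\<Phi> \<in> AJ_sol (AJ_normal_form l \<delta>)" "\<Psi> \<in> AJ_sol (AJ_normal_form l \<delta>)"
    and "\<Phi> $ 1 = \<Psi> $ 1" "\<Phi> $ (l + 1) = \<Psi> $ (l + 1)"
  shows "\<Phi> = \<Psi>"
proof (rule fps_ext)
  fix m
  have c: "\<Phi> \<in> carrier Gamma_inf" "\<Psi> \<in> carrier Gamma_inf" using sol by (simp_all add: AJ_sol_def)
  show "\<Phi> $ m = \<Psi> $ m"
  proof (induction m rule: less_induct)
    case (less m)
    consider "m = 0" | "m = 1" | "m = l + 1" | "m \<ge> 2" "m \<noteq> l + 1" by linarith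
    then show ?case
    proof cases
      case 4
      note diff = fps_power_nth_first_difference[of \<Phi> \<Psi> m, OF _ _ 4(1) less.IH]
      have "(\<Phi> ^ Suc l) $ (m + l) - (\<Psi> ^ Suc l) $ (m + l) = of_nat (Suc l) * (\<Phi> $ 1) ^ l * (\<Phi> $ m - \<Psi> $ m)"
        using c by (intro diff(2)) simp_all
      moreover have "(\<Phi> $ 1) ^ l = 1"
        using AJ_normal_form_sol_nth_1[OF assms(1,2)] by (simp add: E_roots_def)
      moreover have "(\<Phi> ^ Suc (2 * l)) $ (m + l) = (\<Psi> ^ Suc (2 * l)) $ (m + l)"
        using c \<open>l \<ge> 1\<close> by (intro diff(1)) simp_all
      moreover have "\<Phi> $ (m - l) = \<Psi> $ (m - l)"
        using less.IH[of "m - l"] \<open>l \<ge> 1\<close> 4 by simp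
      moreover have "(F ^ Suc l) $ (m + l) + \<delta> * (F ^ Suc (2 * l)) $ (m + l) =
          of_nat m * F $ m + \<delta> * (of_nat (m - l) * F $ (m - l))" if "F \<in> {\<Phi>, \<Psi>}" for F
        using that sol c AJ_normal_form_sol_iff 4(1) by (metis One_nat_def Suc_1 Suc_leD insertE singletonD)
      from this[of \<Phi>] this[of \<Psi>] have
        "(\<Phi> ^ Suc l) $ (m + l) + \<delta> * (\<Phi> ^ Suc (2 * l)) $ (m + l) =
          of_nat m * \<Phi> $ m + \<delta> * (of_nat (m - l) * \<Phi> $ (m - l))"
        "(\<Psi> ^ Suc l) $ (m + l) + \<delta> * (\<Psi> ^ Suc (2 * l)) $ (m + l) =
          of_nat m * \<Psi> $ m + \<delta> * (of_nat (m - l) * \<Psi> $ (m - l))" by simp_all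
      \<comment> \<open>Both equations carry the same \<open>\<delta>\<close>-terms, which cancel in the difference.\<close>
      ultimately have "of_nat (Suc l) * (\<Phi> $ m - \<Psi> $ m) = of_nat m * (\<Phi> $ m - \<Psi> $ m)"
        by (simp only: mult_1_right right_diff_distrib) (metis add_diff_cancel_right)
      then have "of_nat (Suc l) = (of_nat m :: 'a) \<or> \<Phi> $ m - \<Psi> $ m = 0"
        by (auto simp only: mult_cancel_right)
      then show ?thesis using 4(2) by (simp only: of_nat_eq_iff) simp
    qed (use assms c in simp_all)
  qed
qed

lemma lseries_nth:
  assumes "l \<ge> 1"
  shows "lseries l a b q $ (p * l + 1) = (if p = 0 then a else if p = 1 then b else q p)"
proof -
  have "p * l + 1 = l + 1 \<longleftrightarrow> p = 1" "p * l + 1 = 1 \<longleftrightarrow> p = 0" using assms by auto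
  moreover have "\<exists>p'\<ge>2. p * l + 1 = p' * l + 1" if "p \<noteq> 0" "p \<noteq> 1"
    using that by (intro exI[of _ p]) auto
  ultimately show ?thesis using assms by (auto simp: lseries_def)
qed

lemma lseries_nth_1: "l \<ge> 1 \<Longrightarrow> lseries l a b q $ 1 = a"
  using lseries_nth[of l a b q 0] by simp

lemma lseries_nth_Suc_l: "l \<ge> 1 \<Longrightarrow> lseries l a b q $ (l + 1) = b"
  using lseries_nth[of l a b q 1] by simp

lemma lseries_support:
  assumes "lseries l a b q $ m \<noteq> 0"
  shows "\<exists>j. m = j * l + 1"
proof -
  have "m = 0 * l + 1 \<or> m = 1 * l + 1 \<or> (\<exists>p. m = p * l + 1)"
    using assms by (auto simp: lseries_def split: if_splits)
  then show ?thesis by blast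
qed

lemma lseries_scale:
  fixes a b k :: "'a::field"
  shows "fps_const k * lseries l a b q = lseries l (k * a) (k * b) (\<lambda>p. k * q p)"
  by (rule fps_ext) (auto simp: lseries_def)

lemma L_lin_compose: "f $ 0 = 0 \<Longrightarrow> L_lin c oo f = fps_const c * f"
  by (simp add: L_lin_def fps_compose_mult_distrib)

text \<open>
  At exponents outside \<open>l\<nat> + 1\<close> both sides vanish, and at \<open>x\<^sup>l\<^sup>+\<^sup>1\<close> and \<open>x\<^sup>2\<^sup>l\<^sup>+\<^sup>1\<close> the equation holds for
  every choice of \<open>c\<close>. At the later exponents it is the recursion for \<open>Q_pol\<close>: let \<open>g\<close> be the
  series without its term at \<open>x\<^sup>r\<^sup>l\<^sup>+\<^sup>1\<close>. By linearisation that term adds \<open>(l + 1) Q\<^sub>r\<close> to the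
  coefficient of the power \<open>l + 1\<close>, and the rest, the coefficient for \<open>g\<close>, is the sum over
  \<open>U_check\<close>, since indices with \<open>u\<^sub>n\<^sub>-\<^sub>l \<noteq> 0\<close> meet the deleted term.
\<close>

lemma Phi_tilde_sol:
  fixes c \<delta> :: "'a::field_char_0"
  assumes l: "l \<ge> 1"
  shows "Phi_tilde l \<delta> c \<in> AJ_sol (AJ_normal_form l \<delta>)"
proof -
  define q where "q = (\<lambda>p. eval2 (Q_pol l p) c \<delta>)"
  define f where "f = lseries l 1 c q"
  have supp: "\<exists>j. m = j * l + 1" if "f $ m \<noteq> 0" for m
    using that unfolding f_def by (rule lseries_support)
  have f1: "f $ 1 = 1" unfolding f_def by (rule lseries_nth_1[OF l])
  have f0: "f $ 0 = 0" using supp[of 0] by auto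
  have q1: "q 1 = c" unfolding q_def by (rule eval2_Q_pol_1)
  have fq: "f $ (j * l + 1) = q j" if "j \<ge> 1" for j
    using that q1 unfolding f_def lseries_nth[OF l] by auto
  have f_carrier: "f \<in> carrier Gamma_inf" using f0 f1 by simp
  have "(f ^ Suc l) $ (m + l) + \<delta> * (f ^ Suc (2 * l)) $ (m + l) =
      of_nat m * f $ m + \<delta> * (of_nat (m - l) * f $ (m - l))" if "m \<ge> 1" for m
  proof (cases "\<exists>r. m = r * l + 1")
    case False
    have "f $ m = 0" using supp False by blast
    moreover have "f $ (m - l) = 0 \<or> m - l = 0"
    proof (rule ccontr)
      assume "\<not> ?thesis"
      then obtain j where "m - l = j * l + 1" "m \<ge> l" using supp[of "m - l"] by auto
      then have "m = Suc j * l + 1" by simp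
      with False show False by blast
    qed
    moreover have "(f ^ Suc l) $ (m + l) = 0"
    proof (rule ccontr)
      assume "\<not> ?thesis"
      then obtain j where "m + l = j * l + Suc l" using fps_power_nth_residue[of f l, OF supp] by blast
      with False show False by auto
    qed
    moreover have "(f ^ Suc (2 * l)) $ (m + l) = 0"
    proof (rule ccontr)
      assume "\<not> ?thesis"
      then obtain j where "m + l = j * l + Suc (2 * l)" using fps_power_nth_residue[of f l, OF supp] by blast
      then have "m = Suc j * l + 1" by simp
      with False show False by blast
    qed
    ultimately show ?thesis by auto
  next
    case True
    then obtain r where m: "m = r * l + 1" by blast
    consider "r = 0" | "r = 1" | "r \<ge> 2" by linarith
    then show ?thesis
    proof cases
      case 1
      have "(f ^ Suc l) $ Suc l = 1" "(f ^ Suc (2 * l)) $ Suc l = 0"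
        using startsby_zero_power_nth_same[OF f0, of "Suc l"] f1
          startsby_zero_power_prefix[OF f0, of "Suc (2 * l)"] l
        by (simp_all del: power_Suc)
      then show ?thesis using m 1 l f1 by (simp del: power_Suc)
    next
      case 2
      \<comment> \<open>\<open>f\<close> agrees with \<open>x\<close> below \<open>x\<^sup>l\<^sup>+\<^sup>1\<close>, so its powers can be compared with those of \<open>x\<close>.\<close>
      have "(f ^ Suc l) $ (Suc l + l) - (fps_X ^ Suc l) $ (Suc l + l) =
          of_nat (Suc l) * (f $ 1) ^ l * (f $ Suc l - fps_X $ Suc l)"
      proof (rule fps_power_nth_first_difference(2))
        fix j assume "j < Suc l"
        moreover have "f $ j = 0" if "j \<noteq> 1"
        proof (rule ccontr)
          assume "f $ j \<noteq> 0"
          then obtain i where "j = i * l + 1" using supp by blast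
          with \<open>j < Suc l\<close> \<open>j \<noteq> 1\<close> show False by (cases i) auto
        qed
        ultimately show "f $ j = fps_X $ j" using f1 by simp
      qed (use f0 l in simp_all)
      then have "(f ^ Suc l) $ (Suc l + l) = of_nat (Suc l) * c"
        using f1 l fq[of 1] q1 by (simp del: power_Suc of_nat_Suc)
      moreover have "(f ^ Suc (2 * l)) $ (Suc l + l) = 1"
        using startsby_zero_power_nth_same[OF f0, of "Suc (2 * l)"] f1
        by (simp add: mult_2 del: power_Suc)
      ultimately show ?thesis
        using m 2 f1 fq[of 1] q1 by (simp del: power_Suc of_nat_Suc)
    next
      case r: 3
      then obtain s where 3: "r = Suc s" "s \<ge> 1" by (metis Suc_1 Suc_le_D Suc_le_mono)
      define n where "n = (r + 1) * l + 1"
      have mn: "m + l = n" using m by (simp add: n_def)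
      have m2: "m \<ge> 2" using m 3 l by simp
      have fm: "f $ m = q r" using fq[of r] 3 unfolding m by simp
      define g where "g = f - fps_const (q r) * fps_X ^ m"
      have g_nth: "g $ j = (if j = m then 0 else f $ j)" for j
        by (simp add: g_def fm)
      have g_supp: "\<exists>i. j = i * l + 1" if "g $ j \<noteq> 0" for j
        using that supp by (auto simp: g_nth split: if_splits)
      have g_res: "g $ (j * l + 1) = (if j = r then 0 else q j)" if "j \<ge> 1" for j
        using fq[OF that] l m by (simp add: g_nth)
      have "(f ^ Suc l) $ n - (g ^ Suc l) $ n = of_nat (Suc l) * (f $ 1) ^ l * (f $ m - g $ m)"
        unfolding mn[symmetric]
        using m2 f0 by (intro fps_power_nth_first_difference(2)) (auto simp: g_nth)
      then have f_pow: "(f ^ Suc l) $ n = (g ^ Suc l) $ n + of_nat (Suc l) * q r"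
        using f1 fq[of r] 3 m by (simp add: g_nth algebra_simps del: power_Suc of_nat_Suc)
      have "(g ^ (l + 1)) $ n = (\<Sum>u\<in>U_res l n (l + 1). of_rat (B_coeff n (l + 1) u) *
          (\<Prod>j=1..r. (g $ (j * l + 1)) ^ u (j * l + 1)))"
        using l m2 f1 by (intro fps_power_nth_U_res g_supp) (auto simp: n_def g_nth)
      also have "\<dots> = (\<Sum>u\<in>U_check l n. of_rat (B_coeff n (l + 1) u) *
          (\<Prod>j=1..r-1. q j ^ u (j * l + 1)))"
      proof (rule sum.mono_neutral_cong_right)
        have "U_res l n (l + 1) \<subseteq> {1..n} \<rightarrow>\<^sub>E {0..l + 1}" by (auto simp: U_res_def U_idx_def)
        then show "finite (U_res l n (l + 1))" by (rule finite_subset) (auto intro: finite_PiE)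
        show "U_check l n \<subseteq> U_res l n (l + 1)" by (auto simp: U_check_def)
        have nl: "n - l = r * l + 1" by (simp add: n_def)
        show "\<forall>u\<in>U_res l n (l + 1) - U_check l n. of_rat (B_coeff n (l + 1) u) *
            (\<Prod>j=1..r. (g $ (j * l + 1)) ^ u (j * l + 1)) = 0"
        proof
          fix u assume "u \<in> U_res l n (l + 1) - U_check l n"
          then have "u (r * l + 1) \<noteq> 0" by (auto simp: U_check_def nl)
          then have "(g $ (r * l + 1)) ^ u (r * l + 1) = 0" using g_res[of r] 3 by simp
          then have "(\<Prod>j=1..r. (g $ (j * l + 1)) ^ u (j * l + 1)) = 0"
            using r by (intro prod_zero bexI[of _ r]) simp_all
          then show "of_rat (B_coeff n (l + 1) u) * (\<Prod>j=1..r. (g $ (j * l + 1)) ^ u (j * l + 1)) = 0" by simp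
        qed
        fix u assume "u \<in> U_check l n"
        then have "u (r * l + 1) = 0" by (simp add: U_check_def nl)
        then have "(\<Prod>j=1..r. (g $ (j * l + 1)) ^ u (j * l + 1)) = (\<Prod>j=1..s. (g $ (j * l + 1)) ^ u (j * l + 1))"
          using 3 by simp
        also have "\<dots> = (\<Prod>j=1..r-1. q j ^ u (j * l + 1))"
          using 3 by (intro prod.cong) (auto simp: g_res[unfolded One_nat_def add_Suc_right add_0_right])
        finally show "of_rat (B_coeff n (l + 1) u) * (\<Prod>j=1..r. (g $ (j * l + 1)) ^ u (j * l + 1)) =
            of_rat (B_coeff n (l + 1) u) * (\<Prod>j=1..r-1. q j ^ u (j * l + 1))" by simp
      qed
      finally have g_pow: "(g ^ Suc l) $ n = \<dots>" by (simp del: power_Suc)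
      have "(f ^ (2 * l + 1)) $ n = (\<Sum>u\<in>U_res l n (2 * l + 1). of_rat (B_coeff n (2 * l + 1) u) *
          (\<Prod>j=1..r-1. (f $ (j * l + 1)) ^ u (j * l + 1)))"
        using l f1 3 by (intro fps_power_nth_U_res supp) (auto simp: n_def algebra_simps)
      also have "\<dots> = (\<Sum>u\<in>U_res l n (2 * l + 1). of_rat (B_coeff n (2 * l + 1) u) *
          (\<Prod>j=1..r-1. q j ^ u (j * l + 1)))"
        by (intro sum.cong prod.cong arg_cong2[of _ _ _ _ "(*)"] arg_cong2[of _ _ _ _ "(^)"] refl fq) simp
      finally have f_pow2: "(f ^ Suc (2 * l)) $ n = \<dots>" by (simp del: power_Suc)
      have "of_nat ((r - 1) * l) * q r = (g ^ Suc l) $ n + \<delta> * (f ^ Suc (2 * l)) $ n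
          - \<delta> * of_nat ((r - 1) * l + 1) * q (r - 1)"
        unfolding g_pow f_pow2 using eval2_Q_pol_rec[OF r l, of c \<delta>] unfolding q_def n_def .
      moreover have "m - l = (r - 1) * l + 1" "f $ ((r - 1) * l + 1) = q (r - 1)"
        using m 3 fq[of "r - 1"] by simp_all
      moreover have "f $ m = q r" using m 3 fq[of r] by simp
      \<comment> \<open>The factor \<open>m - (l + 1)\<close> left over after linearisation is the \<open>(r - 1) l\<close> divided by in \<open>Q_pol\<close>.\<close>
      moreover have "of_nat m * q r = of_nat (Suc l) * q r + of_nat ((r - 1) * l) * q r"
        unfolding distrib_right[symmetric] of_nat_add[symmetric] using m 3 by simp
      ultimately show ?thesis
        unfolding mn f_pow by (simp add: algebra_simps del: power_Suc of_nat_Suc of_nat_mult of_nat_add)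
    qed
  qed
  then have "f \<in> AJ_sol (AJ_normal_form l \<delta>)"
    unfolding AJ_normal_form_sol_iff[OF f_carrier] by blast
  then show ?thesis by (simp add: f_def q_def Phi_tilde_def)
qed

lemma L_lin_sol:
  assumes "c \<in> E_roots l" "l \<ge> 1"
  shows "L_lin c \<in> AJ_sol (AJ_normal_form l \<delta>)"
proof -
  have c: "c ^ l = 1" using assms by (simp add: E_roots_def)
  then have nz: "c \<noteq> 0" using assms(2) by (auto simp: power_0_left)
  have L0: "L_lin c $ 0 = 0" by (simp add: L_lin_def)
  have pow: "L_lin c ^ (k * l + 1) = fps_const c * fps_X ^ (k * l + 1)" for k
  proof -
    have "c ^ (k * l + 1) = c" using c by (simp add: power_mult mult.commute[of k])
    then show ?thesis by (simp add: L_lin_def power_mult_distrib del: power_Suc power_Suc2)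
  qed
  have "AJ_normal_form l \<delta> oo L_lin c = L_lin c ^ (1 * l + 1) + fps_const \<delta> * L_lin c ^ (2 * l + 1)"
    unfolding AJ_normal_form_def
    by (simp add: fps_compose_add_distrib fps_compose_mult_distrib[OF L0] fps_X_power_compose[OF L0] del: power_Suc)
  also have "\<dots> = fps_const c * AJ_normal_form l \<delta>"
    unfolding pow AJ_normal_form_def by (simp add: algebra_simps del: power_Suc)
  also have "fps_const c = fps_deriv (L_lin c)" by (simp add: L_lin_def)
  finally show ?thesis using nz by (simp add: AJ_sol_def L_lin_def)
qed

lemma Phi_hat_eq_lseries:
  fixes c\<^sub>1 c \<delta> :: "'a::field_char_0"
  assumes "l \<ge> 1" "c\<^sub>1 \<noteq> 0"
  shows "Phi_hat l \<delta> c\<^sub>1 c = lseries l c\<^sub>1 c (\<lambda>p. c\<^sub>1 * eval2 (Q_pol l p) (inverse c\<^sub>1 * c) \<delta>)"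
proof -
  have "Phi_tilde l \<delta> (inverse c\<^sub>1 * c) $ 0 = 0"
    using Phi_tilde_sol[OF assms(1)] by (auto simp: AJ_sol_def)
  then show ?thesis
    using assms(2) by (simp add: Phi_hat_def L_lin_compose) (simp add: Phi_tilde_def lseries_scale flip: mult.assoc)
qed

lemma Phi_hat_sol:
  assumes "l \<ge> 1" "c\<^sub>1 \<in> E_roots l"
  shows "Phi_hat l \<delta> c\<^sub>1 c \<in> AJ_sol (AJ_normal_form l \<delta>)"
  using L_lin_sol[OF assms(2,1)] Phi_tilde_sol[OF assms(1)]
  unfolding Phi_hat_def AJ_sol_iff_change by (rule AJ_change_comp)

lemma E_roots_nonzero: "l \<ge> 1 \<Longrightarrow> c \<in> E_roots l \<Longrightarrow> c \<noteq> 0"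
  by (auto simp: E_roots_def power_0_left)

lemma Phi_hat_coeffs:
  assumes "l \<ge> 1" "c\<^sub>1 \<in> E_roots l"
  shows "Phi_hat l \<delta> c\<^sub>1 c $ 1 = c\<^sub>1" "Phi_hat l \<delta> c\<^sub>1 c $ (l + 1) = c"
  unfolding Phi_hat_eq_lseries[OF assms(1) E_roots_nonzero[OF assms]]
  by (rule lseries_nth_1[OF assms(1)] lseries_nth_Suc_l[OF assms(1)])+

text \<open>
  The family \<open>Phi_hat\<close> realises every admissible pair of coefficients at \<open>x\<close> and \<open>x\<^sup>l\<^sup>+\<^sup>1\<close>, so
  uniqueness leaves no room for other solutions.
\<close>

lemma AJ_normal_form_sol_eq_Phi_hat:
  assumes "l \<ge> 1" "\<Psi> \<in> AJ_sol (AJ_normal_form l \<delta>)"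
  shows "\<Psi> = Phi_hat l \<delta> (\<Psi> $ 1) (\<Psi> $ (l + 1))"
proof -
  note root = AJ_normal_form_sol_nth_1[OF assms]
  show ?thesis
    using Phi_hat_coeffs[OF assms(1) root]
    by (intro AJ_normal_form_sol_unique[OF assms Phi_hat_sol[OF assms(1) root]]) simp_all
qed

lemma AJ_normal_form_sol_subset_N_inf:
  assumes "l \<ge> 1"
  shows "AJ_sol (AJ_normal_form l \<delta>) \<subseteq> (N_inf l :: 'a::field_char_0 fps set)"
proof
  fix \<Psi> :: "'a fps" assume \<Psi>: "\<Psi> \<in> AJ_sol (AJ_normal_form l \<delta>)"
  have "\<Psi> $ 1 \<noteq> 0" by (rule E_roots_nonzero[OF assms AJ_normal_form_sol_nth_1[OF assms \<Psi>]])
  then have "\<Psi> = lseries l (\<Psi> $ 1) (\<Psi> $ (l + 1)) (\<lambda>p. \<Psi> $ 1 * eval2 (Q_pol l p) (inverse (\<Psi> $ 1) * \<Psi> $ (l + 1)) \<delta>)"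
    using AJ_normal_form_sol_eq_Phi_hat[OF assms \<Psi>] Phi_hat_eq_lseries[OF assms] by metis
  then have "\<exists>j. m = j * l + 1" if "\<Psi> $ m \<noteq> 0" for m
    using that lseries_support by metis
  then show "\<Psi> \<in> N_inf l" using \<Psi> by (simp add: N_inf_def AJ_sol_def)
qed

section \<open>The group of two-coefficient jets\<close>

lemma diamond_group_simps [simp]:
  "carrier (diamond_group l) = E_roots l \<times> UNIV"
  "(c\<^sub>1, c\<^sub>2) \<otimes>\<^bsub>diamond_group l\<^esub> (d\<^sub>1, d\<^sub>2) = (c\<^sub>1 * d\<^sub>1, c\<^sub>1 * d\<^sub>2 + d\<^sub>1 * c\<^sub>2)"
  "\<one>\<^bsub>diamond_group l\<^esub> = (1, 0)"
  by (simp_all add: diamond_group_def)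

lemma comm_group_diamond:
  assumes "l \<ge> 1"
  shows "comm_group (diamond_group l :: ('a::field \<times> 'a) monoid)"
proof (rule comm_groupI)
  fix x :: "'a \<times> 'a"
  assume "x \<in> carrier (diamond_group l)"
  then obtain c d where x: "x = (c, d)" "c \<in> E_roots l" by auto
  then have "c \<noteq> 0" using E_roots_nonzero[OF assms] by blast
  then show "\<exists>y\<in>carrier (diamond_group l). y \<otimes>\<^bsub>diamond_group l\<^esub> x = \<one>\<^bsub>diamond_group l\<^esub>"
    using x by (intro bexI[of _ "(inverse c, - inverse c * inverse c * d)"])
      (auto simp: E_roots_def power_inverse)
qed (auto simp: E_roots_def power_mult_distrib algebra_simps)

text \<open>
  The gap between the exponents 1 and \<open>l + 1\<close> in \<open>f\<close> is what makes the coefficients at these two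
  exponents a closed system under substitution, with the law of \<open>diamond_group\<close> once
  \<open>(g $ 1)\<^sup>l = 1\<close>.
\<close>

lemma fps_compose_two_terms:
  fixes f g :: "'a::comm_semiring_1 fps"
  assumes "f $ 0 = 0" "g $ 0 = 0" and gap: "\<And>j. 2 \<le> j \<Longrightarrow> j \<le> l \<Longrightarrow> f $ j = 0"
  shows "2 \<le> j \<Longrightarrow> j \<le> l \<Longrightarrow> (f oo g) $ j = f $ 1 * g $ j"
    and "l \<ge> 1 \<Longrightarrow> (f oo g) $ (l + 1) = f $ 1 * g $ (l + 1) + f $ (l + 1) * (g $ 1) ^ (l + 1)"
proof -
  assume "2 \<le> j" "j \<le> l"
  have "(f oo g) $ j = (\<Sum>i\<in>{1}. f $ i * (g ^ i) $ j)"
    unfolding fps_compose_nth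
  proof (rule sum.mono_neutral_right)
    show "\<forall>i\<in>{0..j} - {1}. f $ i * (g ^ i) $ j = 0"
    proof
      fix i assume i: "i \<in> {0..j} - {1}"
      then have "f $ i = 0" using gap[of i] assms(1) \<open>j \<le> l\<close> by (cases "i = 0") auto
      then show "f $ i * (g ^ i) $ j = 0" by simp
    qed
  qed (use \<open>2 \<le> j\<close> in auto)
  then show "(f oo g) $ j = f $ 1 * g $ j" by simp
next
  assume l: "l \<ge> 1"
  have "(f oo g) $ (l + 1) = (\<Sum>i\<in>{1, l + 1}. f $ i * (g ^ i) $ (l + 1))"
    unfolding fps_compose_nth
  proof (rule sum.mono_neutral_right)
    show "\<forall>i\<in>{0..l + 1} - {1, l + 1}. f $ i * (g ^ i) $ (l + 1) = 0"
    proof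
      fix i assume i: "i \<in> {0..l + 1} - {1, l + 1}"
      then have "f $ i = 0" using gap[of i] assms(1) by (cases "i = 0") auto
      then show "f $ i * (g ^ i) $ (l + 1) = 0" by simp
    qed
  qed auto
  then show "(f oo g) $ (l + 1) = f $ 1 * g $ (l + 1) + f $ (l + 1) * (g $ 1) ^ (l + 1)"
    using l startsby_zero_power_nth_same[OF assms(2), of "l + 1"] by (simp del: power_Suc)
qed

definition jet :: "nat \<Rightarrow> 'a::field \<times> 'a \<Rightarrow> 'a poly" where
  "jet l = (\<lambda>(c\<^sub>1, c\<^sub>2). monom c\<^sub>1 1 + monom c\<^sub>2 (l + 1))"

lemma jet_coeff:
  assumes "l \<ge> 1"
  shows "coeff (jet l (c\<^sub>1, c\<^sub>2)) m = (if m = 1 then c\<^sub>1 else if m = l + 1 then c\<^sub>2 else 0)"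
  using assms by (auto simp: jet_def)

text \<open>
  Presenting \<open>Gamma_ll\<close> as the homomorphic image of a group makes the group axioms, among them
  associativity of truncated substitution, a consequence of those of \<open>diamond_group\<close>.
\<close>

lemma Gamma_ll_eq_jet_image:
  assumes "l \<ge> 1"
  shows "(Gamma_ll l :: 'a::field poly monoid) =
    (Gamma_trunc (l + 1)) \<lparr>carrier := jet l ` carrier (diamond_group l), one := jet l \<one>\<^bsub>diamond_group l\<^esub>\<rparr>"
proof -
  have "degree (jet l (c\<^sub>1, c\<^sub>2)) \<le> l + 1" for c\<^sub>1 c\<^sub>2 :: 'a
    by (rule degree_le) (simp add: jet_coeff[OF assms])
  then have mem: "jet l (c\<^sub>1, c\<^sub>2) \<in> carrier (Gamma_trunc (l + 1))" if "c\<^sub>1 \<in> E_roots l" for c\<^sub>1 c\<^sub>2 :: 'a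
    using that E_roots_nonzero[OF assms that] by (simp add: Gamma_trunc_def jet_coeff[OF assms])
  have "{p \<in> carrier (Gamma_trunc (l + 1)). \<exists>c\<^sub>1\<in>E_roots l. \<exists>c\<^sub>2. p = monom c\<^sub>1 1 + monom c\<^sub>2 (l + 1)} =
      jet l ` (E_roots l \<times> (UNIV :: 'a set))"
    using mem by (auto simp: jet_def)
  moreover have "jet l (1, 0) = [:0, 1 :: 'a:]"
    by (simp add: jet_def monom_altdef)
  ultimately show ?thesis
    by (simp add: Gamma_ll_def Gamma_trunc_def)
qed

lemma jet_hom:
  assumes "l \<ge> 1"
  shows "jet l \<in> hom (diamond_group l) (Gamma_ll l :: 'a::field poly monoid)"
proof (rule homI)
  fix x y :: "'a \<times> 'a"
  assume "x \<in> carrier (diamond_group l)" "y \<in> carrier (diamond_group l)"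
  then obtain c\<^sub>1 c\<^sub>2 d\<^sub>1 d\<^sub>2 where xy: "x = (c\<^sub>1, c\<^sub>2)" "y = (d\<^sub>1, d\<^sub>2)" and d: "d\<^sub>1 \<in> E_roots l" by auto
  define f g where "f = fps_of_poly (jet l x)" and "g = fps_of_poly (jet l y)"
  have nth: "f $ m = (if m = 1 then c\<^sub>1 else if m = l + 1 then c\<^sub>2 else 0)"
      "g $ m = (if m = 1 then d\<^sub>1 else if m = l + 1 then d\<^sub>2 else 0)" for m
    unfolding f_def g_def xy by (simp_all only: fps_of_poly_nth jet_coeff[OF assms])
  have fg: "f $ 0 = 0" "g $ 0 = 0" "\<And>j. 2 \<le> j \<Longrightarrow> j \<le> l \<Longrightarrow> f $ j = 0" using nth by simp_all
  have d1: "d\<^sub>1 ^ (l + 1) = d\<^sub>1" using d by (simp add: E_roots_def)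
  have comp: "coeff (pcompose (jet l x) (jet l y)) m = (f oo g) $ m" for m
    using fg(2) by (simp add: f_def g_def fps_of_poly_pcompose flip: fps_of_poly_nth)
  have "coeff (poly_cutoff (l + 2) (pcompose (jet l x) (jet l y))) m = coeff (jet l (c\<^sub>1 * d\<^sub>1, c\<^sub>1 * d\<^sub>2 + d\<^sub>1 * c\<^sub>2)) m" for m
  proof -
    consider "m = 0" | "m = 1" | "2 \<le> m" "m \<le> l" | "m = l + 1" | "m \<ge> l + 2" by linarith
    then show ?thesis
      unfolding coeff_poly_cutoff comp jet_coeff[OF assms]
    proof cases
      case 2
      then show "(if m < l + 2 then (f oo g) $ m else 0) =
          (if m = 1 then c\<^sub>1 * d\<^sub>1 else if m = l + 1 then c\<^sub>1 * d\<^sub>2 + d\<^sub>1 * c\<^sub>2 else 0)"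
        using nth[of 1] fps_compose_nth_1[of f g] by simp
    next
      case 3
      then show "(if m < l + 2 then (f oo g) $ m else 0) =
          (if m = 1 then c\<^sub>1 * d\<^sub>1 else if m = l + 1 then c\<^sub>1 * d\<^sub>2 + d\<^sub>1 * c\<^sub>2 else 0)"
        using fps_compose_two_terms(1)[OF fg, of l m] nth(2)[of m] by simp
    next
      case 4
      then show "(if m < l + 2 then (f oo g) $ m else 0) =
          (if m = 1 then c\<^sub>1 * d\<^sub>1 else if m = l + 1 then c\<^sub>1 * d\<^sub>2 + d\<^sub>1 * c\<^sub>2 else 0)"
        using fps_compose_two_terms(2)[OF fg assms] nth[of 1] nth[of "l + 1"] d1 assms
        by (simp add: mult.commute del: power_Suc)
    qed (use fg in simp_all)
  qed
  then show "jet l (x \<otimes>\<^bsub>diamond_group l\<^esub> y) = jet l x \<otimes>\<^bsub>Gamma_ll l\<^esub> jet l y"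
    by (intro poly_eqI) (simp add: xy Gamma_ll_def Gamma_trunc_def)
qed (simp add: Gamma_ll_eq_jet_image[OF assms])

lemma jet_iso:
  assumes "l \<ge> 1"
  shows "jet l \<in> iso (diamond_group l) (Gamma_ll l :: 'a::field poly monoid)"
proof (rule isoI[OF jet_hom[OF assms]])
  have "inj (jet l :: 'a \<times> 'a \<Rightarrow> _)"
  proof (rule injI)
    fix x y :: "'a \<times> 'a" assume eq: "jet l x = jet l y"
    obtain c\<^sub>1 c\<^sub>2 d\<^sub>1 d\<^sub>2 where xy: "x = (c\<^sub>1, c\<^sub>2)" "y = (d\<^sub>1, d\<^sub>2)" by fastforce
    have "coeff (jet l x) m = coeff (jet l y) m" for m using eq by simp
    from this[of 1] this[of "l + 1"] show "x = y"
      unfolding xy jet_coeff[OF assms] using assms by simp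
  qed
  then show "bij_betw (jet l) (carrier (diamond_group l)) (carrier (Gamma_ll l :: 'a poly monoid))"
    unfolding Gamma_ll_eq_jet_image[OF assms] by (auto simp: bij_betw_def intro: inj_on_subset)
qed

lemma group_Gamma_ll:
  assumes "l \<ge> 1"
  shows "group (Gamma_ll l :: 'a::field poly monoid)"
proof -
  interpret D: comm_group "diamond_group l :: ('a \<times> 'a) monoid" by (rule comm_group_diamond[OF assms])
  have "group ((Gamma_ll l) \<lparr>carrier := jet l ` carrier (diamond_group l), one := jet l \<one>\<^bsub>diamond_group l\<^esub>\<rparr> :: 'a poly monoid)"
    by (rule D.hom_imp_img_group[OF jet_hom[OF assms]])
  then show ?thesis
    by (simp add: Gamma_ll_eq_jet_image[OF assms])
qed

section \<open>The group of solutions\<close>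

text \<open>
  Solutions have no terms strictly between \<open>x\<close> and \<open>x\<^sup>l\<^sup>+\<^sup>1\<close>, so reading off these two coefficients
  is multiplicative; its inverse is the parametrisation by \<open>Phi_hat\<close>.
\<close>

lemma AJ_normal_form_coeffs_iso:
  fixes \<delta> :: "'a::field_char_0"
  assumes "l \<ge> 1"
  shows "(\<lambda>\<Phi>. (\<Phi> $ 1, \<Phi> $ (l + 1))) \<in> iso (AJ_group (AJ_normal_form l \<delta>)) (diamond_group l)"
proof (rule isoI)
  let ?S = "AJ_sol (AJ_normal_form l \<delta>)"
  note root = AJ_normal_form_sol_nth_1[OF assms]
  show "(\<lambda>\<Phi>. (\<Phi> $ 1, \<Phi> $ (l + 1))) \<in> hom (AJ_group (AJ_normal_form l \<delta>)) (diamond_group l)"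
  proof (rule homI)
    fix \<Phi> \<Psi> assume "\<Phi> \<in> carrier (AJ_group (AJ_normal_form l \<delta>))" "\<Psi> \<in> carrier (AJ_group (AJ_normal_form l \<delta>))"
    then have sol: "\<Phi> \<in> ?S" "\<Psi> \<in> ?S" by simp_all
    then have zero: "\<Phi> $ 0 = 0" "\<Psi> $ 0 = 0" by (simp_all add: AJ_sol_def)
    have gap: "\<Phi> $ j = 0" if "2 \<le> j" "j \<le> l" for j
    proof (rule ccontr)
      assume "\<Phi> $ j \<noteq> 0"
      then obtain p where "j = p * l + 1"
        using AJ_normal_form_sol_subset_N_inf[OF assms, of \<delta>] sol(1) by (auto simp: N_inf_def)
      with that show False by (cases p) auto
    qed
    have "(\<Psi> $ 1) ^ (l + 1) = \<Psi> $ 1" using root[OF sol(2)] by (simp add: E_roots_def)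
    then show "((\<Phi> \<otimes>\<^bsub>AJ_group (AJ_normal_form l \<delta>)\<^esub> \<Psi>) $ 1, (\<Phi> \<otimes>\<^bsub>AJ_group (AJ_normal_form l \<delta>)\<^esub> \<Psi>) $ (l + 1)) =
        (\<Phi> $ 1, \<Phi> $ (l + 1)) \<otimes>\<^bsub>diamond_group l\<^esub> (\<Psi> $ 1, \<Psi> $ (l + 1))"
      using fps_compose_nth_1[of \<Phi> \<Psi>] fps_compose_two_terms(2)[OF zero gap assms]
      by (simp add: mult.commute del: power_Suc One_nat_def)
  qed (use root in simp)
  show "bij_betw (\<lambda>\<Phi>. (\<Phi> $ 1, \<Phi> $ (l + 1))) (carrier (AJ_group (AJ_normal_form l \<delta>))) (carrier (diamond_group l))"
  proof (rule bij_betw_byWitness[where f' = "\<lambda>(c\<^sub>1, c). Phi_hat l \<delta> c\<^sub>1 c"])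
    show "\<forall>\<Phi>\<in>carrier (AJ_group (AJ_normal_form l \<delta>)). (\<lambda>(c\<^sub>1, c). Phi_hat l \<delta> c\<^sub>1 c) (\<Phi> $ 1, \<Phi> $ (l + 1)) = \<Phi>"
      using AJ_normal_form_sol_eq_Phi_hat[OF assms, of _ \<delta>, symmetric] by (simp del: One_nat_def)
    show "\<forall>x\<in>carrier (diamond_group l).
        ((case x of (c\<^sub>1, c) \<Rightarrow> Phi_hat l \<delta> c\<^sub>1 c) $ 1, (case x of (c\<^sub>1, c) \<Rightarrow> Phi_hat l \<delta> c\<^sub>1 c) $ (l + 1)) = x"
      using Phi_hat_coeffs[OF assms] by (auto simp del: One_nat_def)
    show "(\<lambda>\<Phi>. (\<Phi> $ 1, \<Phi> $ (l + 1))) ` carrier (AJ_group (AJ_normal_form l \<delta>)) \<subseteq> carrier (diamond_group l)"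
      using root by (auto simp del: One_nat_def)
    show "(\<lambda>(c\<^sub>1, c). Phi_hat l \<delta> c\<^sub>1 c) ` carrier (diamond_group l) \<subseteq> carrier (AJ_group (AJ_normal_form l \<delta>))"
      using Phi_hat_sol[OF assms] by auto
  qed
qed

lemma comm_group_AJ_normal_form:
  assumes "l \<ge> 1"
  shows "comm_group (AJ_group (AJ_normal_form l (\<delta> :: 'a::field_char_0)))"
proof -
  interpret D: comm_group "diamond_group l :: ('a \<times> 'a) monoid" by (rule comm_group_diamond[OF assms])
  interpret G: group "AJ_group (AJ_normal_form l \<delta>)" by (rule group_AJ_group)
  have "AJ_group (AJ_normal_form l \<delta>) \<cong> (diamond_group l :: ('a \<times> 'a) monoid)"
    by (rule is_isoI[OF AJ_normal_form_coeffs_iso[OF assms]])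
  then show ?thesis by (intro D.iso_imp_comm_group G.iso_sym G.monoid_axioms)
qed

text \<open>
  The solution group is commutative because \<open>diamond_group\<close> is, so normality costs nothing, and
  the factorisation \<open>Phi_hat = L_lin \<circ> Phi_tilde\<close> displays every solution as a product.
\<close>

lemma AJ_normal_form_direct_product:
  fixes \<delta> :: "'a::field_char_0"
  assumes l: "l \<ge> 1"
  defines "H \<equiv> AJ_normal_form l \<delta>"
  shows "internal_direct_product (AJ_group H) (L_set l) (AJ_sol1 H)"
proof -
  interpret G: comm_group "AJ_group H" unfolding H_def by (rule comm_group_AJ_normal_form[OF l])
  have L_sol: "L_lin c \<in> AJ_sol H" if "c \<in> E_roots l" for c
    unfolding H_def by (rule L_lin_sol[OF that l])
  have L_mult: "L_lin c oo L_lin d = L_lin (c * d)" for c d :: 'a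
    using L_lin_compose[of "L_lin d" c] by (simp add: L_lin_def flip: mult.assoc)
  have L_1: "L_lin 1 = (fps_X :: 'a fps)" by (simp add: L_lin_def)
  have "subgroup (L_set l) (AJ_group H)"
  proof (rule G.subgroupI)
    show "L_set l \<subseteq> carrier (AJ_group H)" using L_sol by (auto simp: L_set_def)
    have "L_lin 1 \<in> L_set l" by (simp add: L_set_def E_roots_def)
    then show "L_set l \<noteq> {}" by blast
  next
    fix f :: "'a fps" assume "f \<in> L_set l"
    then obtain c where c: "c \<in> E_roots l" "f = L_lin c" by (auto simp: L_set_def)
    have ic: "inverse c \<in> E_roots l" using c(1) by (simp add: E_roots_def power_inverse)
    have "inv\<^bsub>AJ_group H\<^esub> f = L_lin (inverse c)"
      using c L_sol ic E_roots_nonzero[OF l c(1)] by (intro G.inv_equality) (simp_all add: L_mult L_1)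
    then show "inv\<^bsub>AJ_group H\<^esub> f \<in> L_set l" using ic by (simp add: L_set_def)
  next
    fix f g :: "'a fps" assume "f \<in> L_set l" "g \<in> L_set l"
    then show "f \<otimes>\<^bsub>AJ_group H\<^esub> g \<in> L_set l"
      by (auto simp: L_set_def L_mult E_roots_def power_mult_distrib)
  qed
  then have nL: "normal (L_set l) (AJ_group H)" by (rule G.subgroup_imp_normal)
  have sol1: "f \<in> AJ_sol1 H \<longleftrightarrow> f \<in> AJ_sol H \<and> f $ 1 = 1" for f :: "'a fps"
    by (auto simp: AJ_sol1_def Gamma1_inf_def AJ_sol_def)
  have "subgroup (AJ_sol1 H) (AJ_group H)"
  proof (rule G.subgroupI)
    show "AJ_sol1 H \<subseteq> carrier (AJ_group H)" by (auto simp: AJ_sol1_def)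
    have "fps_X \<in> AJ_sol1 H" using G.one_closed by (simp add: sol1)
    then show "AJ_sol1 H \<noteq> {}" by blast
  next
    fix f :: "'a fps" assume f: "f \<in> AJ_sol1 H"
    then show "inv\<^bsub>AJ_group H\<^esub> f \<in> AJ_sol1 H"
      using G.inv_closed[of f] fps_inv_nth_1[of f] inv_AJ_group[of f H] by (simp add: sol1)
  next
    fix f g :: "'a fps" assume "f \<in> AJ_sol1 H" "g \<in> AJ_sol1 H"
    then show "f \<otimes>\<^bsub>AJ_group H\<^esub> g \<in> AJ_sol1 H"
      using G.m_closed[of f g] fps_compose_nth_1[of f g] by (simp add: sol1)
  qed
  then have n1: "normal (AJ_sol1 H) (AJ_group H)" by (rule G.subgroup_imp_normal)
  have "L_set l \<inter> AJ_sol1 H = {fps_X}"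
  proof
    show "L_set l \<inter> AJ_sol1 H \<subseteq> {fps_X}" by (auto simp: L_set_def sol1 L_lin_def)
    show "{fps_X} \<subseteq> L_set l \<inter> AJ_sol1 H"
      using nL n1 by (auto dest!: normal_imp_subgroup subgroup.one_closed)
  qed
  moreover have "L_set l <#>\<^bsub>AJ_group H\<^esub> AJ_sol1 H = AJ_sol H"
  proof
    show "L_set l <#>\<^bsub>AJ_group H\<^esub> AJ_sol1 H \<subseteq> AJ_sol H"
      using G.set_mult_closed[of "L_set l" "AJ_sol1 H"] normal_imp_subgroup[OF nL] normal_imp_subgroup[OF n1]
      by (simp add: subgroup.subset[of _ "AJ_group H", simplified])
    show "AJ_sol H \<subseteq> L_set l <#>\<^bsub>AJ_group H\<^esub> AJ_sol1 H"
    proof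
      fix \<Psi> assume \<Psi>: "\<Psi> \<in> AJ_sol H"
      then have "\<Psi> = L_lin (\<Psi> $ 1) oo Phi_tilde l \<delta> (inverse (\<Psi> $ 1) * \<Psi> $ (l + 1))"
        using AJ_normal_form_sol_eq_Phi_hat[OF l] unfolding H_def Phi_hat_def by blast
      moreover have "L_lin (\<Psi> $ 1) \<in> L_set l"
        using AJ_normal_form_sol_nth_1[OF l] \<Psi> unfolding H_def L_set_def by blast
      moreover have "Phi_tilde l \<delta> c \<in> AJ_sol1 H" for c
        using Phi_tilde_sol[OF l, of \<delta> c, folded H_def] lseries_nth_1[OF l, of 1 c]
        by (simp add: sol1 Phi_tilde_def)
      ultimately show "\<Psi> \<in> L_set l <#>\<^bsub>AJ_group H\<^esub> AJ_sol1 H"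
        unfolding set_mult_def AJ_group_simps by blast
    qed
  qed
  ultimately show ?thesis
    using nL n1 by (simp add: internal_direct_product_def)
qed

theorem corollary5:
  fixes l :: nat and H H' T :: "'a::field_char_0 fps" and \<delta> :: 'a
  assumes "l \<ge> 1"
    and "\<forall>j\<le>l. H $ j = 0" and "H $ (l + 1) = 1"
    and "H' = fps_X ^ (l + 1) + fps_const \<delta> * fps_X ^ (2 * l + 1)"
    and "transforms_AJ T H H'"
  shows
    "((\<forall>c\<^sub>1\<in>E_roots l. \<forall>c.
         Phi_hat l \<delta> c\<^sub>1 c =
           lseries l c\<^sub>1 c (\<lambda>p. c\<^sub>1 * eval2 (Q_pol l p) (inverse c\<^sub>1 * c) \<delta>) \<and>
         Phi_hat l \<delta> c\<^sub>1 c \<in> AJ_sol H' \<and>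
         Phi_hat l \<delta> c\<^sub>1 c $ 1 = c\<^sub>1 \<and> Phi_hat l \<delta> c\<^sub>1 c $ (l + 1) = c \<and>
         (\<forall>\<Psi>\<in>AJ_sol H'. \<Psi> $ 1 = c\<^sub>1 \<and> \<Psi> $ (l + 1) = c \<longrightarrow> \<Psi> = Phi_hat l \<delta> c\<^sub>1 c)) \<and>
      (\<forall>\<Psi>\<in>AJ_sol H'. \<exists>c\<^sub>1\<in>E_roots l. \<exists>c. \<Psi> = Phi_hat l \<delta> c\<^sub>1 c) \<and>
      AJ_sol H' \<subseteq> N_inf l \<and>
      subgroup (AJ_sol H') Gamma_inf \<and>
      internal_direct_product (AJ_group H') (L_set l) (AJ_sol1 H') \<and>
      group (Gamma_ll l :: 'a poly monoid) \<and>
      group (diamond_group l :: ('a \<times> 'a) monoid) \<and>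
      AJ_group H' \<cong> (Gamma_ll l :: 'a poly monoid) \<and>
      (Gamma_ll l :: 'a poly monoid) \<cong> (diamond_group l :: ('a \<times> 'a) monoid)) \<and>
     ((\<forall>c\<^sub>1\<in>E_roots l. \<forall>c.
         conj_T T (Phi_hat l \<delta> c\<^sub>1 c) =
           conj_T T (L_lin c\<^sub>1) oo conj_T T (Phi_tilde l \<delta> (inverse c\<^sub>1 * c)) \<and>
         conj_T T (Phi_hat l \<delta> c\<^sub>1 c) \<in> AJ_sol H) \<and>
      (\<forall>\<Psi>\<in>AJ_sol H. \<exists>!(c\<^sub>1, c). (c\<^sub>1, c) \<in> E_roots l \<times> UNIV \<and> \<Psi> = conj_T T (Phi_hat l \<delta> c\<^sub>1 c)) \<and>
      subgroup (AJ_sol H) Gamma_inf \<and>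
      internal_direct_product (AJ_group H) (conj_T T ` L_set l) (conj_T T ` AJ_sol1 H') \<and>
      AJ_group H \<cong> (Gamma_ll l :: 'a poly monoid) \<and>
      (Gamma_ll l :: 'a poly monoid) \<cong> (diamond_group l :: ('a \<times> 'a) monoid))"
proof -
  note l = assms(1)
  have H': "H' = AJ_normal_form l \<delta>" using assms(4) by (simp add: AJ_normal_form_def)
  have T: "AJ_change H T H'" by (rule AJ_change_if_transforms[OF assms(5)])
  interpret \<Gamma>: group "Gamma_inf :: 'a fps monoid" by (rule group_Gamma_inf)
  interpret G': group "AJ_group H'" by (rule group_AJ_group)
  interpret G: group "AJ_group H" by (rule group_AJ_group)
  interpret D: comm_group "diamond_group l :: ('a \<times> 'a) monoid" by (rule comm_group_diamond[OF l])
  have conj: "conj_T T \<in> iso (AJ_group H') (AJ_group H)" by (rule conj_T_iso[OF T])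
  then have conj_mult: "conj_T T (F oo G) = conj_T T F oo conj_T T G" if "F \<in> AJ_sol H'" "G \<in> AJ_sol H'" for F G
    using that by (simp add: iso_def hom_def)
  have conj_bij: "bij_betw (conj_T T) (AJ_sol H') (AJ_sol H)"
    using conj by (simp add: iso_def)
  have diamond_ll: "(diamond_group l :: ('a \<times> 'a) monoid) \<cong> (Gamma_ll l :: 'a poly monoid)"
    using jet_iso[OF l] by (rule is_isoI)
  have ll_diamond: "(Gamma_ll l :: 'a poly monoid) \<cong> (diamond_group l :: ('a \<times> 'a) monoid)"
    by (rule D.iso_sym[OF diamond_ll])
  have H'_ll: "AJ_group H' \<cong> (Gamma_ll l :: 'a poly monoid)"
    using is_isoI[OF AJ_normal_form_coeffs_iso[OF l]] diamond_ll unfolding H' by (rule iso_trans)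
  have H_ll: "AJ_group H \<cong> (Gamma_ll l :: 'a poly monoid)"
    using G'.iso_sym[OF is_isoI[OF conj]] H'_ll by (rule iso_trans)
  have sol: "Phi_hat l \<delta> c\<^sub>1 c \<in> AJ_sol H'" if "c\<^sub>1 \<in> E_roots l" for c\<^sub>1 c
    using Phi_hat_sol[OF l that] unfolding H' .
  have form: "\<Psi> $ 1 \<in> E_roots l \<and> \<Psi> = Phi_hat l \<delta> (\<Psi> $ 1) (\<Psi> $ (l + 1))" if "\<Psi> \<in> AJ_sol H'" for \<Psi>
    using AJ_normal_form_sol_nth_1[OF l] AJ_normal_form_sol_eq_Phi_hat[OF l] that unfolding H' by blast
  have ex1: "\<exists>!(c\<^sub>1, c). (c\<^sub>1, c) \<in> E_roots l \<times> UNIV \<and> \<Psi> = conj_T T (Phi_hat l \<delta> c\<^sub>1 c)" if \<Psi>: "\<Psi> \<in> AJ_sol H" for \<Psi>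
  proof -
    obtain \<Phi> where \<Phi>: "\<Phi> \<in> AJ_sol H'" "\<Psi> = conj_T T \<Phi>"
      using \<Psi> conj_bij unfolding bij_betw_def by blast
    have "c\<^sub>1 = \<Phi> $ 1 \<and> c = \<Phi> $ (l + 1)" if "c\<^sub>1 \<in> E_roots l" "\<Psi> = conj_T T (Phi_hat l \<delta> c\<^sub>1 c)" for c\<^sub>1 c
    proof -
      have "\<Phi> = Phi_hat l \<delta> c\<^sub>1 c"
        using bij_betw_imp_inj_on[OF conj_bij] sol[OF that(1)] \<Phi> that(2) by (auto dest: inj_onD)
      then show ?thesis using Phi_hat_coeffs[OF l that(1)] by simp
    qed
    then show ?thesis
      using form[OF \<Phi>(1)] \<Phi>(2) by (intro ex1I[of _ "(\<Phi> $ 1, \<Phi> $ (l + 1))"]) (auto simp del: One_nat_def)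
  qed
  show ?thesis
  proof (intro conjI ballI allI impI)
    fix c\<^sub>1 c :: 'a assume c\<^sub>1: "c\<^sub>1 \<in> E_roots l"
    show "Phi_hat l \<delta> c\<^sub>1 c = lseries l c\<^sub>1 c (\<lambda>p. c\<^sub>1 * eval2 (Q_pol l p) (inverse c\<^sub>1 * c) \<delta>)"
      by (rule Phi_hat_eq_lseries[OF l E_roots_nonzero[OF l c\<^sub>1]])
    show "Phi_hat l \<delta> c\<^sub>1 c \<in> AJ_sol H'" by (rule sol[OF c\<^sub>1])
    show "Phi_hat l \<delta> c\<^sub>1 c $ 1 = c\<^sub>1" "Phi_hat l \<delta> c\<^sub>1 c $ (l + 1) = c"
      by (rule Phi_hat_coeffs[OF l c\<^sub>1])+
    show "\<Psi> = Phi_hat l \<delta> c\<^sub>1 c" if "\<Psi> \<in> AJ_sol H'" "\<Psi> $ 1 = c\<^sub>1 \<and> \<Psi> $ (l + 1) = c" for \<Psi>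
      using form[OF that(1)] that(2) by blast
    show "conj_T T (Phi_hat l \<delta> c\<^sub>1 c) = conj_T T (L_lin c\<^sub>1) oo conj_T T (Phi_tilde l \<delta> (inverse c\<^sub>1 * c))"
      unfolding Phi_hat_def using L_lin_sol[OF c\<^sub>1 l] Phi_tilde_sol[OF l] by (intro conj_mult) (simp_all add: H')
    show "conj_T T (Phi_hat l \<delta> c\<^sub>1 c) \<in> AJ_sol H"
      using sol[OF c\<^sub>1] conj_bij by (rule bij_betw_apply[rotated])
  next
    show "\<exists>c\<^sub>1\<in>E_roots l. \<exists>c. \<Psi> = Phi_hat l \<delta> c\<^sub>1 c" if "\<Psi> \<in> AJ_sol H'" for \<Psi>
      using form[OF that] by blast
    show "AJ_sol H' \<subseteq> N_inf l" unfolding H' by (rule AJ_normal_form_sol_subset_N_inf[OF l])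
    have dp: "internal_direct_product (AJ_group H') (L_set l) (AJ_sol1 H')"
      unfolding H' by (rule AJ_normal_form_direct_product[OF l])
    then show "internal_direct_product (AJ_group H') (L_set l) (AJ_sol1 H')" .
    show "internal_direct_product (AJ_group H) (conj_T T ` L_set l) (conj_T T ` AJ_sol1 H')"
      by (rule internal_direct_product_iso_image[OF G'.group_axioms G.group_axioms conj dp])
  qed (rule ex1 subgroup_AJ_sol group_Gamma_ll[OF l] D.group_axioms H'_ll H_ll ll_diamond | assumption)+
qed

end
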